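(* Let $\mathbf H_1,\dots,\mathbf H_p$ be Hermitian $d\times d$ matrices with $\mathbf H_l^2=\mathbf I$ (two-level Hamiltonians), $\mathbf M$ Hermitian, and $\mathcal S$ any dataset, and suppose the instance is non-degenerate, i.e. $L(\cdot;\mathcal S)$ has finitely many critical points within one period. Then within one period $[0,\pi)^p$, $L(\boldsymbol\theta;\mathcal S)$ has at most $(4p)^p$ local minima.
   Context: A $p$-parameter QNN is given by Hermitian $\mathbf H_1,\dots,\mathbf H_p$ and Hermitian observable $\mathbf M$; $\mathbf U(\boldsymbol\theta)=e^{-i\theta_p\mathbf H_p}\cdots e^{-i\theta_1\mathbf H_1}$. A dataset is a finite set $\mathcal S=\{(\boldsymbol\rho_i,y_i)\}_{i=1}^m$ of density matrices (PSD, trace 1) and real labels, with loss $L(\boldsymbol\theta;\mathcal S)=\frac1m\sum_i\big(\operatorname{tr}(\mathbf U(\boldsymbol\theta)\boldsymbol\rho_i\mathbf U(\boldsymbol\theta)^\dagger\mathbf M)-y_i\big)^2$, which is $\pi$-periodic in each coordinate when $\mathbf H_l^2=\mathbf I$. *)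

theory Defs
  imports "HOL-Analysis.Analysis"
begin

text \<open>Complex d x d matrices are rendered as complex^'d^'d ('d finite).
  Parameter vectors theta in R^p are real^'p, where the finite index type 'p
  carries a linear order fixing the order of the gates in the circuit.\<close>

definition cadj :: "complex^'d^'d \<Rightarrow> complex^'d^'d" where
  "cadj A = (\<chi> i j. cnj (A $ j $ i))"

definition hermitian_mat :: "complex^'d^'d \<Rightarrow> bool" where
  "hermitian_mat A \<longleftrightarrow> cadj A = A"

definition ctrace :: "complex^'d^'d \<Rightarrow> complex" where
  "ctrace A = (\<Sum>i\<in>UNIV. A $ i $ i)"

definition density_mat :: "complex^'d^'d \<Rightarrow> bool" where
  "density_mat \<rho> \<longleftrightarrow> hermitian_mat \<rho>
     \<and> (\<forall>x::complex^'d. 0 \<le> Re (\<Sum>i\<in>UNIV. cnj (x $ i) * (\<rho> *v x) $ i))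
     \<and> ctrace \<rho> = 1"

fun mpow :: "complex^'d^'d \<Rightarrow> nat \<Rightarrow> complex^'d^'d" where
  "mpow A 0 = mat 1"
| "mpow A (Suc k) = A ** mpow A k"

definition mexp :: "complex^'d^'d \<Rightarrow> complex^'d^'d" where
  "mexp A = (\<chi> i j. (\<Sum>k. (mpow A k) $ i $ j / of_nat (fact k)))"

text \<open>U(theta) = e^{-i theta_p H_p} ... e^{-i theta_1 H_1}: the gate with the
  smallest index is applied first (rightmost factor).\<close>
definition qnn_U :: "('p::{finite,linorder} \<Rightarrow> complex^'d::finite^'d) \<Rightarrow> real^('p::{finite,linorder}) \<Rightarrow> complex^'d^'d" where
  "qnn_U H \<theta> = foldl (\<lambda>U l. mexp (\<chi> i j. (- \<i> * complex_of_real (\<theta> $ l)) * H l $ i $ j) ** U)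
                   (mat 1) (sorted_list_of_set UNIV)"

definition qnn_loss :: "('p::{finite,linorder} \<Rightarrow> complex^'d^'d) \<Rightarrow> complex^'d^'d
     \<Rightarrow> ((complex^'d^'d) \<times> real) set \<Rightarrow> real^('p::{finite,linorder}) \<Rightarrow> real" where
  "qnn_loss H M S \<theta> = (1 / real (card S)) *
     (\<Sum>(\<rho>, y)\<in>S. (Re (ctrace (qnn_U H \<theta> ** \<rho> ** cadj (qnn_U H \<theta>) ** M)) - y)\<^sup>2)"

definition critical_point :: "('a::real_normed_vector \<Rightarrow> real) \<Rightarrow> 'a \<Rightarrow> bool" where
  "critical_point f x \<longleftrightarrow> (f has_derivative (\<lambda>_. 0)) (at x)"

definition local_min :: "('a::metric_space \<Rightarrow> real) \<Rightarrow> 'a \<Rightarrow> bool" where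
  "local_min f x \<longleftrightarrow> (\<exists>e>0. \<forall>y. dist y x < e \<longrightarrow> f x \<le> f y)"

definition one_period :: "(real^'p::finite) set" where
  "one_period = {\<theta>. \<forall>l. 0 \<le> \<theta> $ l \<and> \<theta> $ l < pi}"

end

theory Submission
  imports Defs
begin

text \<open>The loss \<open>L\<close> is a trigonometric polynomial of degree at most 2 in each
  \<open>z\<^sub>l = exp (2 i \<theta>\<^sub>l)\<close>. Finiteness of the critical set makes every local minimum strict,
  so for small \<open>\<epsilon> > 0\<close> it survives as a nearby local minimum of
  \<open>L + \<epsilon> \<Sum>l. cos (4 p \<theta>\<^sub>l)\<close>. The critical points of the perturbed function solve a system
  \<open>z\<^sub>l\<^sup>2\<^sup>p - z\<^sub>l\<^sup>-\<^sup>2\<^sup>p = (1/\<epsilon>) Q\<^sub>l(z)\<close> in which the exponents in the Laurent polynomials \<open>Q\<^sub>l\<close> have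
  \<open>\<ell>\<^sub>1\<close>-norm at most \<open>2 p\<close>. For all but countably many \<open>\<epsilon>\<close> these equations reduce every Laurent
  monomial, as a function on the solution set, to a combination of the \<open>(4 p)\<^sup>p\<close> monomials with
  exponents in \<open>[-2 p, 2 p)\<close>; so there are at most \<open>(4 p)\<^sup>p\<close> solutions.\<close>

section \<open>Linear algebra over finite index sets\<close>

text \<open>Gaussian elimination, one equation at a time: an equation with a nonzero coefficient at
  some unknown \<open>y\<close> serves to eliminate \<open>y\<close> from all the others.\<close>

lemma homogeneous_system_nontrivial_solution:
  fixes A :: "'b \<Rightarrow> 'x \<Rightarrow> 'k::field"
  assumes "finite B" "finite X" "card B < card X"
  shows "\<exists>c. (\<exists>x\<in>X. c x \<noteq> 0) \<and> (\<forall>b\<in>B. (\<Sum>x\<in>X. c x * A b x) = 0)"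
  using assms
proof (induction B arbitrary: X A rule: finite_induct)
  case empty
  then have "X \<noteq> {}" by auto
  then show ?case by (intro exI[of _ "\<lambda>_. 1"]) auto
next
  case (insert b B)
  show ?case
  proof (cases "\<forall>x\<in>X. A b x = 0")
    case True
    obtain c where "\<exists>x\<in>X. c x \<noteq> 0" "\<forall>b\<in>B. (\<Sum>x\<in>X. c x * A b x) = 0"
      using insert.IH[of X A] insert.prems insert.hyps by auto
    with True show ?thesis by (intro exI[of _ c]) auto
  next
    case False
    then obtain y where y: "y \<in> X" "A b y \<noteq> 0" by auto
    let ?X = "X - {y}"
    have "card B < card ?X"
      using insert.prems insert.hyps y by (simp add: card_Diff_singleton)
    then obtain c where c: "\<exists>x\<in>?X. c x \<noteq> 0"
      "\<And>b'. b' \<in> B \<Longrightarrow> (\<Sum>x\<in>?X. c x * (A b' x - A b' y * A b x / A b y)) = 0"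
      using insert.IH[of ?X "\<lambda>b' x. A b' x - A b' y * A b x / A b y"] insert.prems by auto
    \<comment> \<open>The value at \<open>y\<close> is chosen to satisfy equation \<open>b\<close>;
      the reduced equations are what the others become after this substitution.\<close>
    define t where "t = (\<Sum>x\<in>?X. c x * A b x)"
    define d where "d = c(y := - t / A b y)"
    have split: "(\<Sum>x\<in>X. d x * A b' x) = (\<Sum>x\<in>?X. c x * A b' x) - t / A b y * A b' y" for b'
    proof -
      have "(\<Sum>x\<in>X. d x * A b' x) = d y * A b' y + (\<Sum>x\<in>?X. d x * A b' x)"
        using insert.prems y by (simp add: sum.remove)
      also have "(\<Sum>x\<in>?X. d x * A b' x) = (\<Sum>x\<in>?X. c x * A b' x)"
        by (rule sum.cong) (auto simp: d_def)
      finally show ?thesis by (simp add: d_def)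
    qed
    have "(\<Sum>x\<in>X. d x * A b x) = 0"
      using y by (simp add: split t_def)
    moreover have "(\<Sum>x\<in>X. d x * A b' x) = 0" if "b' \<in> B" for b'
    proof -
      have "0 = (\<Sum>x\<in>?X. c x * A b' x - (A b' y / A b y) * (c x * A b x))"
        using c(2)[OF that] by (simp add: algebra_simps)
      also have "\<dots> = (\<Sum>x\<in>?X. c x * A b' x) - (A b' y / A b y) * t"
        by (simp only: sum_subtractf t_def sum_distrib_left)
      finally show ?thesis by (simp add: split mult.commute)
    qed
    moreover have "\<exists>x\<in>X. d x \<noteq> 0"
      using c(1) by (auto simp: d_def)
    ultimately show ?thesis by (intro exI[of _ d]) auto
  qed
qed

text \<open>Matrix powers of \<open>K\<close> on the index set \<open>S\<close>. Matrices are plain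
  functions here because \<open>S\<close> will be a sphere of frequencies of given norm, which is a
  set and not a type.\<close>

fun kernel_pow :: "'i set \<Rightarrow> ('i \<Rightarrow> 'i \<Rightarrow> complex) \<Rightarrow> nat \<Rightarrow> 'i \<Rightarrow> 'i \<Rightarrow> complex" where
  "kernel_pow S K 0 i j = (if i = j then 1 else 0)"
| "kernel_pow S K (Suc k) i j = (\<Sum>l\<in>S. K i l * kernel_pow S K k l j)"

lemma kernel_pow_eigenvector:
  assumes "finite S" and eig: "\<And>i. i \<in> S \<Longrightarrow> (\<Sum>j\<in>S. K i j * \<psi> j) = \<mu> * \<psi> i" and "i \<in> S"
  shows "(\<Sum>j\<in>S. kernel_pow S K k i j * \<psi> j) = \<mu> ^ k * \<psi> i"
  using \<open>i \<in> S\<close>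
proof (induction k arbitrary: i)
  case 0
  then have "(\<Sum>j\<in>S. kernel_pow S K 0 i j * \<psi> j) = (\<Sum>j\<in>S. if i = j then \<psi> j else 0)"
    by (intro sum.cong) auto
  with 0 assms(1) show ?case by simp
next
  case (Suc k)
  have "(\<Sum>j\<in>S. kernel_pow S K (Suc k) i j * \<psi> j) = (\<Sum>j\<in>S. \<Sum>l\<in>S. K i l * (kernel_pow S K k l j * \<psi> j))"
    by (simp add: sum_distrib_right mult.assoc)
  also have "\<dots> = (\<Sum>l\<in>S. K i l * (\<Sum>j\<in>S. kernel_pow S K k l j * \<psi> j))"
    by (subst sum.swap) (simp add: sum_distrib_left)
  also have "\<dots> = (\<Sum>l\<in>S. \<mu> ^ k * (K i l * \<psi> l))"
    by (rule sum.cong) (auto simp: Suc.IH)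
  also have "\<dots> = \<mu> ^ Suc k * \<psi> i"
    using eig[OF Suc.prems] by (simp flip: sum_distrib_left)
  finally show ?case .
qed

text \<open>The powers of \<open>K\<close> are linearly dependent, and every eigenvalue is a root of the dependency.\<close>

lemma finite_eigenvalues:
  fixes K :: "'i \<Rightarrow> 'i \<Rightarrow> complex"
  assumes S: "finite S"
  shows "finite {\<mu>. \<exists>\<psi>. (\<exists>i\<in>S. \<psi> i \<noteq> 0) \<and> (\<forall>i\<in>S. (\<Sum>j\<in>S. K i j * \<psi> j) = \<mu> * \<psi> i)}"
proof -
  \<comment> \<open>\<open>{..n}\<close> contains \<open>n + 1\<close> exponents, one more than
    there are matrix entries, that is, equations.\<close>
  define n where "n = card (S \<times> S)"
  obtain c where c: "\<exists>k\<in>{..n}. c k \<noteq> 0"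
    "\<And>i j. i \<in> S \<Longrightarrow> j \<in> S \<Longrightarrow> (\<Sum>k\<le>n. c k * kernel_pow S K k i j) = 0"
    using homogeneous_system_nontrivial_solution[of "S \<times> S" "{..n}" "\<lambda>(i, j) k. kernel_pow S K k i j"] S
    by (force simp: n_def)
  have "finite {\<mu>. (\<Sum>k\<le>n. c k * \<mu> ^ k) = 0}"
    using c(1) by (subst polyfun_finite_roots) auto
  moreover have "(\<Sum>k\<le>n. c k * \<mu> ^ k) = 0"
    if "i \<in> S" "\<psi> i \<noteq> 0" and eig: "\<And>i. i \<in> S \<Longrightarrow> (\<Sum>j\<in>S. K i j * \<psi> j) = \<mu> * \<psi> i" for \<mu> \<psi> i
  proof -
    have "(\<Sum>k\<le>n. c k * \<mu> ^ k) * \<psi> i = (\<Sum>k\<le>n. c k * (\<Sum>j\<in>S. kernel_pow S K k i j * \<psi> j))"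
      using kernel_pow_eigenvector[OF S eig \<open>i \<in> S\<close>] by (simp add: sum_distrib_right mult.assoc)
    also have "\<dots> = (\<Sum>j\<in>S. (\<Sum>k\<le>n. c k * kernel_pow S K k i j) * \<psi> j)"
      by (simp add: sum_distrib_left sum_distrib_right mult.assoc) (rule sum.swap)
    also have "\<dots> = 0"
      using c(2) that by simp
    finally show ?thesis using that by simp
  qed
  ultimately show ?thesis
    by (elim finite_subset[rotated]) auto
qed

section \<open>Generic Laurent systems\<close>

definition freq_norm :: "('p::finite \<Rightarrow> int) \<Rightarrow> int" where
  "freq_norm \<alpha> = (\<Sum>l\<in>UNIV. \<bar>\<alpha> l\<bar>)"

lemma freq_norm_nonneg: "0 \<le> freq_norm \<alpha>"
  by (simp add: freq_norm_def sum_nonneg)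

lemma freq_norm_upd: "freq_norm (\<alpha>(l := v)) = freq_norm \<alpha> - \<bar>\<alpha> l\<bar> + \<bar>v\<bar>"
proof -
  have "(\<Sum>j\<in>UNIV - {l}. \<bar>(\<alpha>(l := v)) j\<bar>) = (\<Sum>j\<in>UNIV - {l}. \<bar>\<alpha> j\<bar>)"
    by (rule sum.cong) auto
  then show ?thesis
    by (simp add: freq_norm_def sum.remove[where x = l and A = UNIV])
qed

lemma freq_norm_add: "freq_norm (\<lambda>j. \<alpha> j + \<beta> j) \<le> freq_norm \<alpha> + freq_norm \<beta>"
  unfolding freq_norm_def by (simp add: sum_mono flip: sum.distrib)

lemma finite_bounded_freqs: "finite {\<alpha> :: 'p::finite \<Rightarrow> int. \<forall>l. \<alpha> l \<in> {a l..b l}}"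
proof -
  have "{\<alpha>. \<forall>l. \<alpha> l \<in> {a l..b l}} = PiE UNIV (\<lambda>l. {a l..b l})"
    by (auto simp: PiE_def)
  then show ?thesis by (simp add: finite_PiE)
qed

lemma finite_freq_norm_sphere: "finite {\<alpha> :: 'p::finite \<Rightarrow> int. freq_norm \<alpha> = N}"
proof (rule finite_subset[OF _ finite_bounded_freqs[of "\<lambda>_. - N" "\<lambda>_. N"]], safe)
  fix \<alpha> :: "'p \<Rightarrow> int" and l
  have "\<bar>\<alpha> l\<bar> \<le> freq_norm \<alpha>"
    unfolding freq_norm_def by (rule member_le_sum) auto
  then show "\<alpha> l \<in> {- freq_norm \<alpha>..freq_norm \<alpha>}" by auto
qed

text \<open>For points \<open>x\<close> solving the Laurent system
  \<open>z\<^sub>l\<^sup>m - z\<^sub>l\<^sup>-\<^sup>m = \<delta> \<Sum>\<beta>\<in>F. b l \<beta> z\<^sup>\<beta>\<close>, the moments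
  \<open>\<phi> \<alpha> = \<Sum>x. c x z(x)\<^sup>\<alpha>\<close> of any weights \<open>c\<close> satisfy this recurrence.\<close>

definition moment_recurrence ::
  "('p::finite \<Rightarrow> int) set \<Rightarrow> ('p \<Rightarrow> ('p \<Rightarrow> int) \<Rightarrow> complex) \<Rightarrow> int \<Rightarrow> complex \<Rightarrow> (('p \<Rightarrow> int) \<Rightarrow> complex) \<Rightarrow> bool" where
  "moment_recurrence F b m \<delta> \<phi> \<longleftrightarrow>
     (\<forall>\<gamma> l. \<phi> (\<gamma>(l := \<gamma> l + m)) = \<phi> (\<gamma>(l := \<gamma> l - m)) + \<delta> * (\<Sum>\<beta>\<in>F. b l \<beta> * \<phi> (\<lambda>j. \<gamma> j + \<beta> j)))"

text \<open>Half-open because the recurrence at \<open>\<gamma> l = 0\<close> ties exponent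
  \<open>m\<close> to exponent \<open>- m\<close>; each coordinate keeps \<open>2 * m\<close>
  values.\<close>

definition freq_box :: "int \<Rightarrow> ('p::finite \<Rightarrow> int) set" where
  "freq_box m = {\<alpha>. \<forall>l. \<alpha> l \<in> {-m..<m}}"

text \<open>Describes moments for which level \<open>N\<close> is the first one where they could be
  nonzero.\<close>

definition vanishes_below ::
  "('p::finite \<Rightarrow> int) set \<Rightarrow> ('p \<Rightarrow> ('p \<Rightarrow> int) \<Rightarrow> complex) \<Rightarrow> int \<Rightarrow> int \<Rightarrow> complex \<Rightarrow> (('p \<Rightarrow> int) \<Rightarrow> complex) \<Rightarrow> bool" where
  "vanishes_below F b m N \<delta> \<phi> \<longleftrightarrow> moment_recurrence F b m \<delta> \<phi> \<and> (\<forall>\<alpha>\<in>freq_box m. \<phi> \<alpha> = 0)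
     \<and> (\<forall>\<alpha>. freq_norm \<alpha> < N \<longrightarrow> \<phi> \<alpha> = 0)"

text \<open>Summands strictly inside the sphere vanish. The coefficients \<open>k\<close> are chosen
  before \<open>\<phi>\<close>, so that they can form a row of one fixed matrix.\<close>

lemma shifted_sum_on_sphere:
  fixes F :: "('p::finite \<Rightarrow> int) set"
  assumes "finite F" and le: "\<And>\<beta>. \<beta> \<in> F \<Longrightarrow> freq_norm (\<lambda>j. \<gamma> j + \<beta> j) \<le> N"
  shows "\<exists>k. \<forall>\<phi>. (\<forall>\<alpha>. freq_norm \<alpha> < N \<longrightarrow> \<phi> \<alpha> = 0) \<longrightarrow>
    (\<Sum>\<beta>\<in>F. c \<beta> * \<phi> (\<lambda>j. \<gamma> j + \<beta> j)) = (\<Sum>\<eta>\<in>{\<eta>. freq_norm \<eta> = N}. k \<eta> * (\<phi> \<eta> :: complex))"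
  using assms
proof (induction F rule: finite_induct)
  case empty
  show ?case by (intro exI[of _ "\<lambda>_. 0"]) simp
next
  case (insert \<beta> F)
  have "\<exists>k. \<forall>\<phi>. (\<forall>\<alpha>. freq_norm \<alpha> < N \<longrightarrow> \<phi> \<alpha> = 0) \<longrightarrow>
    (\<Sum>\<beta>\<in>F. c \<beta> * \<phi> (\<lambda>j. \<gamma> j + \<beta> j)) = (\<Sum>\<eta>\<in>{\<eta>. freq_norm \<eta> = N}. k \<eta> * \<phi> \<eta>)"
    by (rule insert.IH) (simp add: insert.prems)
  then obtain k where k: "\<forall>\<phi>. (\<forall>\<alpha>. freq_norm \<alpha> < N \<longrightarrow> \<phi> \<alpha> = 0) \<longrightarrow>
    (\<Sum>\<beta>\<in>F. c \<beta> * \<phi> (\<lambda>j. \<gamma> j + \<beta> j)) = (\<Sum>\<eta>\<in>{\<eta>. freq_norm \<eta> = N}. k \<eta> * \<phi> \<eta>)" ..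
  let ?\<eta> = "\<lambda>j. \<gamma> j + \<beta> j"
  show ?case
  proof (intro exI[of _ "\<lambda>\<eta>. k \<eta> + (if \<eta> = ?\<eta> then c \<beta> else 0)"] allI impI)
    fix \<phi> :: "('p \<Rightarrow> int) \<Rightarrow> complex"
    assume \<phi>: "\<forall>\<alpha>. freq_norm \<alpha> < N \<longrightarrow> \<phi> \<alpha> = 0"
    have "(\<Sum>\<eta>\<in>{\<eta>. freq_norm \<eta> = N}. (if \<eta> = ?\<eta> then c \<beta> else 0) * \<phi> \<eta>)
        = (\<Sum>\<eta>\<in>{\<eta>. freq_norm \<eta> = N}. if \<eta> = ?\<eta> then c \<beta> * \<phi> ?\<eta> else 0)"
      by (rule sum.cong) auto
    also have "\<dots> = (if freq_norm ?\<eta> = N then c \<beta> * \<phi> ?\<eta> else 0)"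
      by (subst sum.delta) (auto simp: finite_freq_norm_sphere)
    also have "\<dots> = c \<beta> * \<phi> ?\<eta>"
      using \<phi> insert.prems[of \<beta>] by auto
    finally show "(\<Sum>\<beta>\<in>insert \<beta> F. c \<beta> * \<phi> (\<lambda>j. \<gamma> j + \<beta> j))
        = (\<Sum>\<eta>\<in>{\<eta>. freq_norm \<eta> = N}. (k \<eta> + (if \<eta> = ?\<eta> then c \<beta> else 0)) * \<phi> \<eta>)"
      using insert.hyps k[rule_format, OF \<phi>[rule_format]] by (simp add: distrib_right sum.distrib)
  qed
qed

text \<open>In a coordinate outside \<open>{-m..<m}\<close>, the recurrence moves that coordinate by
  \<open>2 * m\<close> towards the other side of zero. The new frequency has smaller norm, where
  \<open>\<phi>\<close> vanishes, except that \<open>m\<close> goes to \<open>- m\<close> at equal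
  norm; then fewer coordinates are at least \<open>m\<close>, hence the induction on their number.
  What remains carries a factor \<open>\<delta>\<close>, and \<open>k\<close> depends on neither
  \<open>\<delta>\<close> nor \<open>\<phi>\<close>.\<close>

lemma recurrence_row:
  fixes F :: "('p::finite \<Rightarrow> int) set"
  assumes F: "finite F" and Fm: "\<And>\<beta>. \<beta> \<in> F \<Longrightarrow> freq_norm \<beta> \<le> m" and m: "0 < m"
    and N: "freq_norm \<alpha> = N"
  shows "\<exists>k. \<forall>\<delta> \<phi>. vanishes_below F b m N \<delta> \<phi> \<longrightarrow>
    \<phi> \<alpha> = \<delta> * (\<Sum>\<eta>\<in>{\<eta>. freq_norm \<eta> = N}. k \<eta> * \<phi> \<eta>)"
  using N
proof (induction "card {l. m \<le> \<alpha> l}" arbitrary: \<alpha> rule: less_induct)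
  case less
  let ?S = "{\<eta>. freq_norm \<eta> = N}"
  \<comment> \<open>The centre \<open>\<alpha>(l := v)\<close> has norm at most
    \<open>N - m\<close>, so adding a \<open>\<beta>\<close> of norm at most \<open>m\<close> does
    not leave the ball of radius \<open>N\<close>.\<close>
  have row: "\<exists>k. \<forall>\<delta> \<phi>. vanishes_below F b m N \<delta> \<phi> \<longrightarrow>
      (\<Sum>\<beta>\<in>F. b l \<beta> * \<phi> (\<lambda>j. (\<alpha>(l := v)) j + \<beta> j)) = (\<Sum>\<eta>\<in>?S. k \<eta> * \<phi> \<eta>)"
    if v: "\<bar>v\<bar> + m \<le> \<bar>\<alpha> l\<bar>" for l v
  proof -
    have "freq_norm (\<lambda>j. (\<alpha>(l := v)) j + \<beta> j) \<le> N" if "\<beta> \<in> F" for \<beta>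
      using freq_norm_add[of "\<alpha>(l := v)" \<beta>] Fm[OF that] v less.prems freq_norm_upd[of \<alpha> l v] by linarith
    from shifted_sum_on_sphere[of F "\<alpha>(l := v)" N "b l", OF F this]
    obtain k where k: "\<forall>\<phi>. (\<forall>\<alpha>. freq_norm \<alpha> < N \<longrightarrow> \<phi> \<alpha> = 0) \<longrightarrow>
        (\<Sum>\<beta>\<in>F. b l \<beta> * \<phi> (\<lambda>j. (\<alpha>(l := v)) j + \<beta> j)) = (\<Sum>\<eta>\<in>?S. k \<eta> * \<phi> \<eta>)"
      by (rule exE)
    show ?thesis
    proof (intro exI allI impI)
      fix \<delta> \<phi> assume "vanishes_below F b m N \<delta> \<phi>"
      then show "(\<Sum>\<beta>\<in>F. b l \<beta> * \<phi> (\<lambda>j. (\<alpha>(l := v)) j + \<beta> j)) = (\<Sum>\<eta>\<in>?S. k \<eta> * \<phi> \<eta>)"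
        unfolding vanishes_below_def by (intro k[rule_format]) simp
    qed
  qed
  \<comment> \<open>The recurrence centred \<open>m\<close> below \<open>\<alpha> l\<close>, and in
    \<open>down\<close> centred \<open>m\<close> above it, solved for
    \<open>\<phi> \<alpha>\<close>.\<close>
  have up: "\<phi> \<alpha> = \<phi> (\<alpha>(l := \<alpha> l - 2 * m)) + \<delta> * (\<Sum>\<beta>\<in>F. b l \<beta> * \<phi> (\<lambda>j. (\<alpha>(l := \<alpha> l - m)) j + \<beta> j))"
    if "vanishes_below F b m N \<delta> \<phi>" for \<delta> \<phi> l
    using that[unfolded vanishes_below_def moment_recurrence_def, THEN conjunct1, rule_format, of "\<alpha>(l := \<alpha> l - m)" l]
    by (simp add: algebra_simps)
  have down: "\<phi> \<alpha> = \<phi> (\<alpha>(l := \<alpha> l + 2 * m)) - \<delta> * (\<Sum>\<beta>\<in>F. b l \<beta> * \<phi> (\<lambda>j. (\<alpha>(l := \<alpha> l + m)) j + \<beta> j))"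
    if "vanishes_below F b m N \<delta> \<phi>" for \<delta> \<phi> l
    using that[unfolded vanishes_below_def moment_recurrence_def, THEN conjunct1, rule_format, of "\<alpha>(l := \<alpha> l + m)" l]
    by (simp add: algebra_simps)
  consider (box) "\<alpha> \<in> freq_box m" | (edge) l where "\<alpha> l = m" | (above) l where "m < \<alpha> l" | (below) l where "\<alpha> l < - m"
  proof (cases "\<alpha> \<in> freq_box m")
    case False
    then obtain l where "\<alpha> l \<notin> {-m..<m}"
      by (auto simp: freq_box_def)
    then show thesis
      using edge[of l] above[of l] below[of l] by fastforce
  qed (rule box)
  then show ?case
  proof cases
    case box
    then show ?thesis by (intro exI[of _ "\<lambda>_. 0"]) (auto simp: vanishes_below_def)
  next
    case edge
    let ?\<alpha> = "\<alpha>(l := \<alpha> l - 2 * m)"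
    have "{j. m \<le> ?\<alpha> j} = {j. m \<le> \<alpha> j} - {l}"
      using edge m by auto
    then have "card {j. m \<le> ?\<alpha> j} < card {j. m \<le> \<alpha> j}"
      using edge by (simp only: card_Diff1_less[of "{j. m \<le> \<alpha> j}" l] finite mem_Collect_eq)
    moreover have "freq_norm ?\<alpha> = N"
      using less.prems edge m by (simp add: freq_norm_upd)
    ultimately obtain k where k: "\<forall>\<delta> \<phi>. vanishes_below F b m N \<delta> \<phi> \<longrightarrow> \<phi> ?\<alpha> = \<delta> * (\<Sum>\<eta>\<in>?S. k \<eta> * \<phi> \<eta>)"
      using less.hyps by blast
    obtain k' where k': "\<forall>\<delta> \<phi>. vanishes_below F b m N \<delta> \<phi> \<longrightarrow>
        (\<Sum>\<beta>\<in>F. b l \<beta> * \<phi> (\<lambda>j. (\<alpha>(l := \<alpha> l - m)) j + \<beta> j)) = (\<Sum>\<eta>\<in>?S. k' \<eta> * \<phi> \<eta>)"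
      using row[of "\<alpha> l - m" l] edge m by auto
    show ?thesis
    proof (intro exI[of _ "\<lambda>\<eta>. k \<eta> + k' \<eta>"] allI impI)
      fix \<delta> \<phi> assume \<phi>: "vanishes_below F b m N \<delta> \<phi>"
      show "\<phi> \<alpha> = \<delta> * (\<Sum>\<eta>\<in>?S. (k \<eta> + k' \<eta>) * \<phi> \<eta>)"
        using up[OF \<phi>, of l] k[rule_format, OF \<phi>] k'[rule_format, OF \<phi>]
        by (simp add: distrib_right sum.distrib distrib_left)
    qed
  next
    case above
    obtain k where k: "\<forall>\<delta> \<phi>. vanishes_below F b m N \<delta> \<phi> \<longrightarrow>
        (\<Sum>\<beta>\<in>F. b l \<beta> * \<phi> (\<lambda>j. (\<alpha>(l := \<alpha> l - m)) j + \<beta> j)) = (\<Sum>\<eta>\<in>?S. k \<eta> * \<phi> \<eta>)"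
      using row[of "\<alpha> l - m" l] above m by auto
    have "freq_norm (\<alpha>(l := \<alpha> l - 2 * m)) < N"
      using less.prems above m by (simp add: freq_norm_upd)
    then have zero: "\<phi> (\<alpha>(l := \<alpha> l - 2 * m)) = 0" if "vanishes_below F b m N \<delta> \<phi>" for \<delta> \<phi>
      using that by (simp add: vanishes_below_def)
    show ?thesis
    proof (intro exI allI impI)
      fix \<delta> \<phi> assume \<phi>: "vanishes_below F b m N \<delta> \<phi>"
      show "\<phi> \<alpha> = \<delta> * (\<Sum>\<eta>\<in>?S. k \<eta> * \<phi> \<eta>)"
        using up[OF \<phi>, of l] k[rule_format, OF \<phi>] zero[OF \<phi>] by simp
    qed
  next
    case below
    obtain k where k: "\<forall>\<delta> \<phi>. vanishes_below F b m N \<delta> \<phi> \<longrightarrow>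
        (\<Sum>\<beta>\<in>F. b l \<beta> * \<phi> (\<lambda>j. (\<alpha>(l := \<alpha> l + m)) j + \<beta> j)) = (\<Sum>\<eta>\<in>?S. k \<eta> * \<phi> \<eta>)"
      using row[of "\<alpha> l + m" l] below m by auto
    have "freq_norm (\<alpha>(l := \<alpha> l + 2 * m)) < N"
      using less.prems below m by (simp add: freq_norm_upd)
    then have zero: "\<phi> (\<alpha>(l := \<alpha> l + 2 * m)) = 0" if "vanishes_below F b m N \<delta> \<phi>" for \<delta> \<phi>
      using that by (simp add: vanishes_below_def)
    show ?thesis
    proof (intro exI[of _ "\<lambda>\<eta>. - k \<eta>"] allI impI)
      fix \<delta> \<phi> assume \<phi>: "vanishes_below F b m N \<delta> \<phi>"
      show "\<phi> \<alpha> = \<delta> * (\<Sum>\<eta>\<in>?S. - k \<eta> * \<phi> \<eta>)"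
        using down[OF \<phi>, of l] k[rule_format, OF \<phi>] zero[OF \<phi>] by (simp add: sum_negf)
    qed
  qed
qed

text \<open>The rows form a fixed matrix \<open>K\<close> on the sphere such that
  \<open>\<phi>\<close> equals \<open>\<delta>\<close> times its image under \<open>K\<close>. If
  \<open>\<phi>\<close> is nonzero there, then \<open>\<delta>\<close> is nonzero and its inverse is
  one of the finitely many eigenvalues of \<open>K\<close>.\<close>

lemma finite_exceptional_level:
  fixes F :: "('p::finite \<Rightarrow> int) set"
  assumes F: "finite F" and Fm: "\<And>\<beta>. \<beta> \<in> F \<Longrightarrow> freq_norm \<beta> \<le> m" and m: "0 < m"
  shows "finite {\<delta>. \<exists>\<phi> \<alpha>. vanishes_below F b m N \<delta> \<phi> \<and> freq_norm \<alpha> = N \<and> \<phi> \<alpha> \<noteq> 0}"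
proof -
  let ?S = "{\<eta> :: 'p \<Rightarrow> int. freq_norm \<eta> = N}"
  have "\<forall>\<alpha>\<in>?S. \<exists>k. \<forall>\<delta> \<phi>. vanishes_below F b m N \<delta> \<phi> \<longrightarrow> \<phi> \<alpha> = \<delta> * (\<Sum>\<eta>\<in>?S. k \<eta> * \<phi> \<eta>)"
    by (intro ballI recurrence_row[OF F Fm m]) auto
  from bchoice[OF this] obtain K where "\<forall>\<alpha>\<in>?S. \<forall>\<delta> \<phi>. vanishes_below F b m N \<delta> \<phi> \<longrightarrow>
      \<phi> \<alpha> = \<delta> * (\<Sum>\<eta>\<in>?S. K \<alpha> \<eta> * \<phi> \<eta>)" ..
  then have K: "\<phi> \<alpha> = \<delta> * (\<Sum>\<eta>\<in>?S. K \<alpha> \<eta> * \<phi> \<eta>)"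
    if "freq_norm \<alpha> = N" "vanishes_below F b m N \<delta> \<phi>" for \<alpha> \<delta> \<phi>
    using that by simp
  let ?E = "{\<mu>. \<exists>\<psi>. (\<exists>i\<in>?S. \<psi> i \<noteq> 0) \<and> (\<forall>i\<in>?S. (\<Sum>j\<in>?S. K i j * \<psi> j) = \<mu> * \<psi> i)}"
  have "\<delta> \<in> inverse ` ?E"
    if \<phi>: "vanishes_below F b m N \<delta> \<phi>" and \<alpha>: "freq_norm \<alpha> = N" "\<phi> \<alpha> \<noteq> 0" for \<delta> \<phi> \<alpha>
  proof (rule image_eqI)
    define s where "s i = (\<Sum>j\<in>?S. K i j * \<phi> j)" for i
    have s: "\<phi> i = \<delta> * s i" if "freq_norm i = N" for i
      unfolding s_def by (rule K[OF that \<phi>])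
    have "\<delta> \<noteq> 0"
      using s[OF \<alpha>(1)] \<alpha>(2) by auto
    then have "s i = inverse \<delta> * \<phi> i" if "i \<in> ?S" for i
      using s[of i] that by simp
    then show "inverse \<delta> \<in> ?E"
      unfolding s_def using \<alpha> by (intro CollectI exI[of _ \<phi>] conjI bexI[of _ \<alpha>] ballI) simp_all
  qed simp
  then have "{\<delta>. \<exists>\<phi> \<alpha>. vanishes_below F b m N \<delta> \<phi> \<and> freq_norm \<alpha> = N \<and> \<phi> \<alpha> \<noteq> 0} \<subseteq> inverse ` ?E"
    by (intro subsetI, elim CollectE exE conjE)
  moreover have "finite (inverse ` ?E)"
    by (intro finite_imageI finite_eigenvalues finite_freq_norm_sphere)
  ultimately show ?thesis
    by (rule finite_subset)
qed

text \<open>Each level contributes finitely many exceptional values, so all levels together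
  contribute countably many. Away from these, vanishing spreads outwards by induction on the
  norm.\<close>

lemma countable_exceptional_moments:
  fixes F :: "('p::finite \<Rightarrow> int) set"
  assumes F: "finite F" and Fm: "\<forall>\<beta>\<in>F. freq_norm \<beta> \<le> m" and m: "0 < m"
  shows "\<exists>D. countable D \<and> (\<forall>\<delta> \<phi>. \<delta> \<notin> D \<longrightarrow> moment_recurrence F b m \<delta> \<phi> \<longrightarrow>
    (\<forall>\<alpha>\<in>freq_box m. \<phi> \<alpha> = 0) \<longrightarrow> (\<forall>\<alpha>. \<phi> \<alpha> = 0))"
proof (intro exI conjI allI impI)
  let ?D = "\<lambda>N. {\<delta>. \<exists>\<phi> \<alpha>. vanishes_below F b m N \<delta> \<phi> \<and> freq_norm \<alpha> = N \<and> \<phi> \<alpha> \<noteq> 0}"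
  show "countable (\<Union>N. ?D N)"
    by (intro countable_UN countableI_type countable_finite finite_exceptional_level[OF F Fm[rule_format] m])
  fix \<delta> \<phi> \<alpha>
  assume \<delta>: "\<delta> \<notin> (\<Union>N. ?D N)" and rec: "moment_recurrence F b m \<delta> \<phi>"
    and box: "\<forall>\<alpha>\<in>freq_box m. \<phi> \<alpha> = 0"
  show "\<phi> \<alpha> = 0"
  proof (induction "nat (freq_norm \<alpha>)" arbitrary: \<alpha> rule: less_induct)
    case less
    then have "\<phi> \<beta> = 0" if "freq_norm \<beta> < freq_norm \<alpha>" for \<beta>
      using that freq_norm_nonneg[of \<beta>] by (simp add: nat_mono_iff)
    with rec box have "vanishes_below F b m (freq_norm \<alpha>) \<delta> \<phi>"
      by (simp add: vanishes_below_def)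
    with \<delta> show ?case by auto
  qed
qed

section \<open>Characters of the torus and their moments\<close>

definition chr :: "('p::finite \<Rightarrow> int) \<Rightarrow> real^'p \<Rightarrow> complex" where
  "chr \<alpha> \<theta> = cis (2 * (\<Sum>l\<in>UNIV. of_int (\<alpha> l) * \<theta> $ l))"

text \<open>Doubling the angle makes \<open>pi\<close> the period: two parameters have the same
  torus point exactly when they agree modulo \<open>pi\<close> in every coordinate.\<close>

definition torus_point :: "real^'p::finite \<Rightarrow> complex^'p" where
  "torus_point \<theta> = (\<chi> l. cis (2 * \<theta> $ l))"

lemma chr_zero [simp]: "chr (\<lambda>_. 0) \<theta> = 1"
  by (simp add: chr_def)

lemma chr_add: "chr (\<lambda>j. \<alpha> j + \<beta> j) \<theta> = chr \<alpha> \<theta> * chr \<beta> \<theta>"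
  by (simp add: chr_def cis_mult distrib_right distrib_left sum.distrib)

lemma chr_single: "chr ((\<lambda>_. 0)(l := k)) \<theta> = cis (2 * of_int k * \<theta> $ l)"
proof -
  have "(\<Sum>j\<in>UNIV. of_int (((\<lambda>_. 0)(l := k)) j) * \<theta> $ j) = (\<Sum>j\<in>UNIV. if j = l then of_int k * \<theta> $ l else 0)"
    by (rule sum.cong) auto
  then show ?thesis
    by (simp add: chr_def mult.assoc)
qed

lemma torus_point_nth: "torus_point \<theta> $ l = chr ((\<lambda>_. 0)(l := 1)) \<theta>"
  by (simp add: torus_point_def chr_single)

lemma chr_shift: "chr (\<gamma>(l := \<gamma> l + k)) \<theta> = chr \<gamma> \<theta> * chr ((\<lambda>_. 0)(l := k)) \<theta>"
proof -
  have "\<gamma>(l := \<gamma> l + k) = (\<lambda>j. \<gamma> j + ((\<lambda>_. 0)(l := k)) j)"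
    by auto
  then show ?thesis by (simp only: chr_add)
qed

text \<open>This identifies \<open>chr \<alpha>\<close> with a Laurent monomial in the torus
  coordinates. It thus depends on the torus point alone, which later gives the periodicity of
  trigonometric sums.\<close>

lemma chr_prod: "chr \<alpha> \<theta> = (\<Prod>l\<in>UNIV. (torus_point \<theta> $ l) powi \<alpha> l)"
proof -
  have "cis (\<Sum>l\<in>A. f l) = (\<Prod>l\<in>A. cis (f l))" if "finite A" for f and A :: "'a set"
    using that by (induction rule: finite_induct) (simp_all flip: cis_mult)
  then show ?thesis
    by (simp add: chr_def torus_point_def cis_power_int sum_distrib_left mult_ac)
qed

text \<open>Products of factors \<open>z\<^sub>l - z\<^sub>l(y)\<close> yield a function
  vanishing at all points but \<open>x\<close>.\<close>

lemma chr_moments_zero: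
  fixes X :: "(real^'p::finite) set"
  assumes X: "finite X" "inj_on torus_point X" and x: "x \<in> X"
    and c: "\<And>\<alpha>. (\<Sum>y\<in>X. c y * chr \<alpha> y) = 0"
  shows "c x = 0"
proof -
  have "\<exists>h. h x \<noteq> 0 \<and> (\<forall>y\<in>Y. h y = 0) \<and> (\<forall>\<alpha>. (\<Sum>y\<in>X. c y * h y * chr \<alpha> y) = 0)"
    if "finite Y" "Y \<subseteq> X - {x}" for Y
    using that
  proof (induction rule: finite_induct)
    case empty
    then show ?case using c by (intro exI[of _ "\<lambda>_. 1"]) simp
  next
    case (insert y Y)
    then obtain h where h: "h x \<noteq> 0" "\<forall>y\<in>Y. h y = 0" "\<And>\<alpha>. (\<Sum>y\<in>X. c y * h y * chr \<alpha> y) = 0"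
      by auto
    have "torus_point x \<noteq> torus_point y"
      using X(2) x insert.prems by (auto dest: inj_onD)
    then obtain l where l: "torus_point x $ l \<noteq> torus_point y $ l"
      by (auto simp: vec_eq_iff)
    let ?g = "\<lambda>u. h u * (torus_point u $ l - torus_point y $ l)"
    \<comment> \<open>The new factor kills \<open>y\<close>. It keeps all moments zero because
      multiplication by a torus coordinate only shifts \<open>\<alpha>\<close>.\<close>
    have "(\<Sum>u\<in>X. c u * ?g u * chr \<alpha> u) = 0" for \<alpha>
    proof -
      have "(\<Sum>u\<in>X. c u * ?g u * chr \<alpha> u) =
          (\<Sum>u\<in>X. c u * h u * chr (\<alpha>(l := \<alpha> l + 1)) u - torus_point y $ l * (c u * h u * chr \<alpha> u))"
        by (rule sum.cong[OF refl]) (simp only: chr_shift torus_point_nth, simp add: algebra_simps)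
      also have "\<dots> = 0"
        using h(3) by (simp add: sum_subtractf flip: sum_distrib_left)
      finally show ?thesis .
    qed
    with h l show ?case by (intro exI[of _ ?g]) auto
  qed
  from this[of "X - {x}"] X obtain h where
    h: "h x \<noteq> 0" "\<forall>y\<in>X - {x}. h y = 0" "\<And>\<alpha>. (\<Sum>y\<in>X. c y * h y * chr \<alpha> y) = 0"
    by auto
  have "(\<Sum>y\<in>X. c y * h y * chr (\<lambda>_. 0) y) = c x * h x"
    using X x h(2) by (simp add: sum.remove)
  then show ?thesis
    using h(1) h(3)[of "\<lambda>_. 0"] by simp
qed

lemma card_freq_box: "0 < m \<Longrightarrow> card (freq_box m :: ('p::finite \<Rightarrow> int) set) = nat (2 * m) ^ CARD('p)"
  and finite_freq_box: "finite (freq_box m :: ('p::finite \<Rightarrow> int) set)"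
proof -
  have eq: "(freq_box m :: ('p \<Rightarrow> int) set) = PiE UNIV (\<lambda>_. {-m..<m})"
    by (auto simp: freq_box_def PiE_def)
  show "card (freq_box m :: ('p::finite \<Rightarrow> int) set) = nat (2 * m) ^ CARD('p)" if "0 < m"
    using that by (simp add: eq card_PiE)
  show "finite (freq_box m :: ('p::finite \<Rightarrow> int) set)"
    by (simp add: eq finite_PiE)
qed

text \<open>If the system had more solutions than \<open>freq_box m\<close> has elements, some nonzero weights on
  the solutions would have vanishing moments on \<open>freq_box m\<close>, hence everywhere.\<close>

lemma generic_laurent_system_bound:
  fixes F :: "('p::finite \<Rightarrow> int) set"
  assumes F: "finite F" and Fm: "\<forall>\<beta>\<in>F. freq_norm \<beta> \<le> m" and m: "0 < m"
  obtains D where "countable D"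
    "\<And>\<delta> X. \<delta> \<notin> D \<Longrightarrow> finite X \<Longrightarrow> inj_on torus_point X \<Longrightarrow>
       (\<And>x l. x \<in> X \<Longrightarrow> chr ((\<lambda>_. 0)(l := m)) x - chr ((\<lambda>_. 0)(l := - m)) x = \<delta> * (\<Sum>\<beta>\<in>F. b l \<beta> * chr \<beta> x)) \<Longrightarrow>
       card X \<le> nat (2 * m) ^ CARD('p)"
proof -
  obtain D where D: "countable D" and D': "\<forall>\<delta> \<phi>. \<delta> \<notin> D \<longrightarrow> moment_recurrence F b m \<delta> \<phi> \<longrightarrow>
      (\<forall>\<alpha>\<in>freq_box m. \<phi> \<alpha> = 0) \<longrightarrow> (\<forall>\<alpha>. \<phi> \<alpha> = 0)"
    using countable_exceptional_moments[OF F Fm m, where b = b] by (elim exE conjE)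
  show thesis
  proof (rule that[OF D])
    fix \<delta> and X :: "(real^'p) set"
    assume \<delta>: "\<delta> \<notin> D" and X: "finite X" "inj_on torus_point X"
      and sys: "\<And>x l. x \<in> X \<Longrightarrow> chr ((\<lambda>_. 0)(l := m)) x - chr ((\<lambda>_. 0)(l := - m)) x = \<delta> * (\<Sum>\<beta>\<in>F. b l \<beta> * chr \<beta> x)"
    show "card X \<le> nat (2 * m) ^ CARD('p)"
    proof (rule ccontr)
      assume "\<not> card X \<le> nat (2 * m) ^ CARD('p)"
      then have "card (freq_box m :: ('p \<Rightarrow> int) set) < card X"
        using m by (simp add: card_freq_box)
      from homogeneous_system_nontrivial_solution[OF finite_freq_box X(1) this, where A = chr]
      obtain c where c: "\<exists>x\<in>X. c x \<noteq> 0" "\<And>\<alpha>. \<alpha> \<in> freq_box m \<Longrightarrow> (\<Sum>x\<in>X. c x * chr \<alpha> x) = 0"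
        by auto
      let ?\<phi> = "\<lambda>\<alpha>. \<Sum>x\<in>X. c x * chr \<alpha> x"
      \<comment> \<open>Equation \<open>l\<close> of the system, multiplied by
        \<open>c x * chr \<gamma> x\<close> and summed over \<open>x\<close>, is the recurrence for
        the moments.\<close>
      have "?\<phi> (\<gamma>(l := \<gamma> l + m)) = ?\<phi> (\<gamma>(l := \<gamma> l - m)) + \<delta> * (\<Sum>\<beta>\<in>F. b l \<beta> * ?\<phi> (\<lambda>j. \<gamma> j + \<beta> j))" for \<gamma> l
      proof -
        have "?\<phi> (\<gamma>(l := \<gamma> l + m)) = (\<Sum>x\<in>X. c x * chr (\<gamma>(l := \<gamma> l - m)) x + \<delta> * (\<Sum>\<beta>\<in>F. b l \<beta> * (c x * chr (\<lambda>j. \<gamma> j + \<beta> j) x)))"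
        proof (rule sum.cong)
          fix x assume x: "x \<in> X"
          have top: "chr ((\<lambda>_. 0)(l := m)) x = chr ((\<lambda>_. 0)(l := - m)) x + \<delta> * (\<Sum>\<beta>\<in>F. b l \<beta> * chr \<beta> x)"
            using sys[OF x, of l] by (simp add: algebra_simps)
          have "c x * chr (\<gamma>(l := \<gamma> l + m)) x = c x * chr \<gamma> x * (chr ((\<lambda>_. 0)(l := - m)) x + \<delta> * (\<Sum>\<beta>\<in>F. b l \<beta> * chr \<beta> x))"
            by (simp only: chr_shift top mult.assoc)
          also have "\<dots> = c x * (chr \<gamma> x * chr ((\<lambda>_. 0)(l := - m)) x) + \<delta> * (\<Sum>\<beta>\<in>F. b l \<beta> * (c x * chr (\<lambda>j. \<gamma> j + \<beta> j) x))"
            by (simp add: distrib_left sum_distrib_left chr_add mult_ac)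
          also have "chr \<gamma> x * chr ((\<lambda>_. 0)(l := - m)) x = chr (\<gamma>(l := \<gamma> l - m)) x"
            using chr_shift[of \<gamma> l "- m" x] by simp
          finally show "c x * chr (\<gamma>(l := \<gamma> l + m)) x = c x * chr (\<gamma>(l := \<gamma> l - m)) x + \<delta> * (\<Sum>\<beta>\<in>F. b l \<beta> * (c x * chr (\<lambda>j. \<gamma> j + \<beta> j) x))" .
        qed simp
        also have "\<dots> = ?\<phi> (\<gamma>(l := \<gamma> l - m)) + \<delta> * (\<Sum>x\<in>X. \<Sum>\<beta>\<in>F. b l \<beta> * (c x * chr (\<lambda>j. \<gamma> j + \<beta> j) x))"
          by (simp only: sum.distrib sum_distrib_left)
        also have "(\<Sum>x\<in>X. \<Sum>\<beta>\<in>F. b l \<beta> * (c x * chr (\<lambda>j. \<gamma> j + \<beta> j) x)) = (\<Sum>\<beta>\<in>F. b l \<beta> * ?\<phi> (\<lambda>j. \<gamma> j + \<beta> j))"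
          by (subst sum.swap) (simp only: sum_distrib_left)
        finally show ?thesis .
      qed
      then have "moment_recurrence F b m \<delta> ?\<phi>"
        unfolding moment_recurrence_def by blast
      then have "?\<phi> \<alpha> = 0" for \<alpha>
        using D' \<delta> c(2) by (metis (no_types, lifting))
      then have "c x = 0" if "x \<in> X" for x
        using chr_moments_zero[OF X that] by blast
      with c(1) show False by blast
    qed
  qed
qed

section \<open>The loss as a trigonometric polynomial\<close>

text \<open>The degree bound \<open>k\<close> is kept per coordinate because a gate raises the
  degree only in its own parameter. The inductive form makes closure properties easy; coefficients
  are extracted only once, in \<open>trig_poly_expansion\<close>.\<close>

inductive trig_poly :: "('p::finite \<Rightarrow> int) \<Rightarrow> (real^'p \<Rightarrow> complex) \<Rightarrow> bool" for k where
  zero: "trig_poly k (\<lambda>_. 0)"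
| step: "(\<And>l. \<bar>\<alpha> l\<bar> \<le> k l) \<Longrightarrow> trig_poly k f \<Longrightarrow> trig_poly k (\<lambda>\<theta>. c * chr \<alpha> \<theta> + f \<theta>)"

lemma trig_poly_chr: "(\<And>l. \<bar>\<alpha> l\<bar> \<le> k l) \<Longrightarrow> trig_poly k (\<lambda>\<theta>. c * chr \<alpha> \<theta>)"
  using trig_poly.step[of \<alpha> k "\<lambda>_. 0" c, OF _ trig_poly.zero] by simp

lemma trig_poly_const: "(\<And>l. 0 \<le> k l) \<Longrightarrow> trig_poly k (\<lambda>\<theta>. c)"
  using trig_poly_chr[of "\<lambda>_. 0" k c] by simp

lemma trig_poly_add: "trig_poly k f \<Longrightarrow> trig_poly k g \<Longrightarrow> trig_poly k (\<lambda>\<theta>. f \<theta> + g \<theta>)"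
  by (induction rule: trig_poly.induct) (auto simp: add.assoc intro: trig_poly.step)

lemma trig_poly_sum:
  assumes "\<And>i. i \<in> I \<Longrightarrow> trig_poly k (f i)"
  shows "trig_poly k (\<lambda>\<theta>. \<Sum>i\<in>I. f i \<theta>)"
  using assms
  by (induction I rule: infinite_finite_induct) (auto intro: trig_poly.zero trig_poly_add)

lemma trig_poly_chr_mult:
  assumes "trig_poly k f" "\<And>l. \<bar>\<alpha> l\<bar> \<le> k' l"
  shows "trig_poly (\<lambda>l. k l + k' l) (\<lambda>\<theta>. c * chr \<alpha> \<theta> * f \<theta>)"
  using assms(1)
proof (induction rule: trig_poly.induct)
  case zero
  then show ?case by (simp add: trig_poly.zero)
next
  case (step \<beta> f d)
  have "\<bar>\<beta> l + \<alpha> l\<bar> \<le> k l + k' l" for l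
    using step.hyps(1)[of l] assms(2)[of l] by linarith
  then have "trig_poly (\<lambda>l. k l + k' l) (\<lambda>\<theta>. (c * d) * chr (\<lambda>j. \<beta> j + \<alpha> j) \<theta> + c * chr \<alpha> \<theta> * f \<theta>)"
    using step.IH by (rule trig_poly.step)
  then show ?case by (simp add: chr_add algebra_simps)
qed

lemma trig_poly_mult:
  assumes "trig_poly k f" "trig_poly k' g"
  shows "trig_poly (\<lambda>l. k l + k' l) (\<lambda>\<theta>. f \<theta> * g \<theta>)"
  using assms(2)
proof (induction rule: trig_poly.induct)
  case zero
  then show ?case by (simp add: trig_poly.zero)
next
  case (step \<alpha> g c)
  then show ?case
    using trig_poly_add[OF trig_poly_chr_mult[OF assms(1) step.hyps(1)] step.IH, of c]
    by (simp add: algebra_simps)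
qed

lemma trig_poly_cmult: "trig_poly k f \<Longrightarrow> trig_poly k (\<lambda>\<theta>. c * f \<theta>)"
  using trig_poly_chr_mult[of k f "\<lambda>_. 0" "\<lambda>_. 0" c] by simp

lemma trig_poly_mult_const: "trig_poly k f \<Longrightarrow> trig_poly k (\<lambda>\<theta>. f \<theta> * c)"
  using trig_poly_cmult[of k f c] by (simp add: mult.commute)

lemma cnj_chr: "cnj (chr \<alpha> \<theta>) = chr (\<lambda>l. - \<alpha> l) \<theta>"
  by (simp add: chr_def cis_cnj sum_negf)

lemma trig_poly_cnj: "trig_poly k f \<Longrightarrow> trig_poly k (\<lambda>\<theta>. cnj (f \<theta>))"
  by (induction rule: trig_poly.induct) (auto simp: cnj_chr intro: trig_poly.intros)

text \<open>Collects terms of equal frequency over one explicit finite set, the form in which the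
  Laurent system takes its right-hand sides.\<close>

lemma trig_poly_expansion:
  assumes "trig_poly k f"
  shows "\<exists>a. \<forall>\<theta>. f \<theta> = (\<Sum>\<alpha>\<in>{\<alpha>. \<forall>l. \<alpha> l \<in> {- k l..k l}}. a \<alpha> * chr \<alpha> \<theta>)"
  using assms
proof (induction rule: trig_poly.induct)
  case zero
  then show ?case by (intro exI[of _ "\<lambda>_. 0"]) simp
next
  case (step \<beta> f c)
  let ?F = "{\<alpha>. \<forall>l. \<alpha> l \<in> {- k l..k l}}"
  from step.IH obtain a where a: "\<forall>\<theta>. f \<theta> = (\<Sum>\<alpha>\<in>?F. a \<alpha> * chr \<alpha> \<theta>)" ..
  have "\<beta> \<in> ?F"
    using step.hyps(1) by (simp add: abs_le_iff minus_le_iff)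
  then have "(\<Sum>\<alpha>\<in>?F. (if \<alpha> = \<beta> then c * chr \<beta> \<theta> else 0)) = c * chr \<beta> \<theta>" for \<theta>
    by (subst sum.delta[OF finite_bounded_freqs]) simp
  moreover have "(\<Sum>\<alpha>\<in>?F. (if \<alpha> = \<beta> then c else 0) * chr \<alpha> \<theta>) = (\<Sum>\<alpha>\<in>?F. (if \<alpha> = \<beta> then c * chr \<beta> \<theta> else 0))" for \<theta>
    by (rule sum.cong) auto
  ultimately show ?case using a
    by (intro exI[of _ "\<lambda>\<alpha>. (if \<alpha> = \<beta> then c else 0) + a \<alpha>"]) (simp add: distrib_right sum.distrib)
qed

text \<open>Since \<open>H\<close> squares to the identity, half of the identity plus or minus
  \<open>H\<close> are complementary projections, on which \<open>c\<close> times \<open>H\<close>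
  acts as \<open>c\<close> and as \<open>- c\<close>.\<close>

lemma mpow_involution:
  fixes H :: "complex^'d::finite^'d"
  assumes invol: "H ** H = mat 1"
  shows "mpow (\<chi> i j. c * H $ i $ j) k $ i $ j
    = c ^ k * ((mat 1 $ i $ j + H $ i $ j) / 2) + (- c) ^ k * ((mat 1 $ i $ j - H $ i $ j) / 2)"
proof (induction k arbitrary: i j)
  case 0
  show ?case by (simp add: field_simps)
next
  case (Suc k)
  have one: "(\<Sum>l\<in>UNIV. H $ i $ l * (mat 1 :: complex^'d^'d) $ l $ j) = H $ i $ j"
    using arg_cong[OF matrix_mul_rid[of H], of "\<lambda>A. A $ i $ j"] by (simp add: matrix_matrix_mult_def)
  have sq: "(\<Sum>l\<in>UNIV. H $ i $ l * H $ l $ j) = (mat 1 :: complex^'d^'d) $ i $ j"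
    using arg_cong[OF invol, of "\<lambda>A. A $ i $ j"] by (simp add: matrix_matrix_mult_def)
  have "mpow (\<chi> i j. c * H $ i $ j) (Suc k) $ i $ j = (\<Sum>l\<in>UNIV. c * H $ i $ l *
      (c ^ k * ((mat 1 $ l $ j + H $ l $ j) / 2) + (- c) ^ k * ((mat 1 $ l $ j - H $ l $ j) / 2)))"
    by (simp add: matrix_matrix_mult_def Suc.IH)
  also have "\<dots> = (\<Sum>l\<in>UNIV. (c * (c ^ k + (- c) ^ k) / 2) * (H $ i $ l * mat 1 $ l $ j)
      + (c * (c ^ k - (- c) ^ k) / 2) * (H $ i $ l * H $ l $ j))"
    by (rule sum.cong) (simp_all add: field_simps)
  also have "\<dots> = (c * (c ^ k + (- c) ^ k) / 2) * H $ i $ j + (c * (c ^ k - (- c) ^ k) / 2) * mat 1 $ i $ j"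
    by (simp only: sum.distrib one sq flip: sum_distrib_left)
  also have "\<dots> = c ^ Suc k * ((mat 1 $ i $ j + H $ i $ j) / 2) + (- c) ^ Suc k * ((mat 1 $ i $ j - H $ i $ j) / 2)"
    by (simp add: field_simps)
  finally show ?case .
qed

lemma mexp_involution:
  fixes H :: "complex^'d::finite^'d"
  assumes "H ** H = mat 1"
  shows "mexp (\<chi> i j. c * H $ i $ j) $ i $ j
    = exp c * ((mat 1 $ i $ j + H $ i $ j) / 2) + exp (- c) * ((mat 1 $ i $ j - H $ i $ j) / 2)"
proof -
  have e: "(\<lambda>k. x ^ k / of_nat (fact k)) sums exp x" for x :: complex
    using exp_converges[of x] by (simp add: scaleR_conv_of_real divide_inverse mult.commute)
  define p q where "p = (mat 1 $ i $ j + H $ i $ j) / 2" and "q = (mat 1 $ i $ j - H $ i $ j) / 2"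
  have "(\<lambda>k. c ^ k / of_nat (fact k) * p + (- c) ^ k / of_nat (fact k) * q) sums (exp c * p + exp (- c) * q)"
    by (intro sums_add sums_mult2 e)
  moreover have "mpow (\<chi> i j. c * H $ i $ j) k $ i $ j / of_nat (fact k)
      = c ^ k / of_nat (fact k) * p + (- c) ^ k / of_nat (fact k) * q" for k
    unfolding mpow_involution[OF assms] p_def[symmetric] q_def[symmetric] by (simp add: add_divide_distrib)
  ultimately show ?thesis
    unfolding p_def[symmetric] q_def[symmetric] by (simp add: mexp_def sums_iff)
qed

lemma cadj_mult: "cadj (A ** B) = cadj B ** cadj (A :: complex^'d::finite^'d)"
  by (simp add: cadj_def matrix_matrix_mult_def vec_eq_iff cnj_sum mult.commute)

lemma conjugation_nth:
  fixes A B X :: "complex^'d::finite^'d"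
  shows "(A ** X ** cadj B) $ i $ j = (\<Sum>b\<in>UNIV. \<Sum>a\<in>UNIV. (A $ i $ a * cnj (B $ j $ b)) * X $ a $ b)"
  by (simp add: matrix_matrix_mult_def cadj_def sum_distrib_left sum_distrib_right mult_ac)

lemma cadj_mat_1 [simp]: "cadj (mat 1 :: complex^'d::finite^'d) = mat 1"
  by (auto simp: cadj_def mat_def vec_eq_iff)

text \<open>A gate entry involves \<open>cis\<close> of plus or minus the undoubled angle, half a
  frequency of \<open>chr\<close>. Only the product of an entry with a conjugated entry has the
  integer frequencies -1, 0 and 1.\<close>

lemma trig_poly_gate:
  fixes H :: "complex^'d::finite^'d" and l :: "'p::finite"
  assumes "H ** H = mat 1"
  defines "E \<equiv> \<lambda>\<theta> :: real^'p. mexp (\<chi> i j. (- \<i> * complex_of_real (\<theta> $ l)) * H $ i $ j)"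
  shows "trig_poly (\<lambda>j. if j = l then 1 else 0) (\<lambda>\<theta>. E \<theta> $ i $ a * cnj (E \<theta> $ j $ b))"
proof -
  define P Q where "P = (\<lambda>i j. (mat 1 $ i $ j + H $ i $ j) / 2)" and "Q = (\<lambda>i j. (mat 1 $ i $ j - H $ i $ j) / 2)"
  have E: "E \<theta> $ i $ j = cis (- (\<theta> $ l)) * P i j + cis (\<theta> $ l) * Q i j" for \<theta> i j
    unfolding E_def mexp_involution[OF assms(1)] P_def Q_def by (simp add: cis_conv_exp)
  have "E \<theta> $ i $ a * cnj (E \<theta> $ j $ b) = (P i a * cnj (P j b) + Q i a * cnj (Q j b))
     + ((P i a * cnj (Q j b)) * chr ((\<lambda>_. 0)(l := - 1)) \<theta> + (Q i a * cnj (P j b)) * chr ((\<lambda>_. 0)(l := 1)) \<theta>)" for \<theta>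
  proof -
    define z where "z = cis (\<theta> $ l)"
    have z: "cnj z * z = 1" "chr ((\<lambda>_. 0)(l := 1)) \<theta> = z * z" "chr ((\<lambda>_. 0)(l := - 1)) \<theta> = cnj z * cnj z" "cis (- (\<theta> $ l)) = cnj z"
      by (simp_all add: z_def chr_single cis_cnj cis_mult)
    have "E \<theta> $ i $ a * cnj (E \<theta> $ j $ b) = (cnj z * z) * (P i a * cnj (P j b) + Q i a * cnj (Q j b))
      + ((P i a * cnj (Q j b)) * (cnj z * cnj z) + (Q i a * cnj (P j b)) * (z * z))"
      by (simp add: E z(4) algebra_simps flip: z_def)
    then show ?thesis by (simp only: z mult_1)
  qed
  moreover have "trig_poly (\<lambda>j. if j = l then 1 else 0) (\<lambda>\<theta>. (P i a * cnj (P j b) + Q i a * cnj (Q j b))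
     + ((P i a * cnj (Q j b)) * chr ((\<lambda>_. 0)(l := - 1)) \<theta> + (Q i a * cnj (P j b)) * chr ((\<lambda>_. 0)(l := 1)) \<theta>))"
    by (intro trig_poly_add trig_poly_const trig_poly_chr) auto
  ultimately show ?thesis by simp
qed

text \<open>The evolved state is tracked instead of the unitary, since conjugation by a gate uses
  exactly the products of \<open>trig_poly_gate\<close>. The last gate of the list is outermost,
  hence the reverse induction.\<close>

lemma trig_poly_conjugation:
  fixes H :: "'p::finite \<Rightarrow> complex^'d::finite^'d" and \<rho> :: "complex^'d^'d"
  assumes invol: "\<And>l. H l ** H l = mat 1" and "distinct ls"
  defines "E \<equiv> \<lambda>l (\<theta> :: real^'p). mexp (\<chi> i j. (- \<i> * complex_of_real (\<theta> $ l)) * H l $ i $ j)"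
  defines "U \<equiv> \<lambda>ls \<theta>. foldl (\<lambda>U l. E l \<theta> ** U) (mat 1) ls"
  shows "trig_poly (\<lambda>l. if l \<in> set ls then 1 else 0) (\<lambda>\<theta>. (U ls \<theta> ** \<rho> ** cadj (U ls \<theta>)) $ i $ j)"
  using \<open>distinct ls\<close>
proof (induction ls arbitrary: i j rule: rev_induct)
  case Nil
  show ?case by (simp add: U_def trig_poly_const)
next
  case (snoc l ls)
  have "(U (ls @ [l]) \<theta> ** \<rho> ** cadj (U (ls @ [l]) \<theta>)) $ i $ j
      = (\<Sum>b\<in>UNIV. \<Sum>a\<in>UNIV. (E l \<theta> $ i $ a * cnj (E l \<theta> $ j $ b)) * (U ls \<theta> ** \<rho> ** cadj (U ls \<theta>)) $ a $ b)" for \<theta>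
  proof -
    have "U (ls @ [l]) \<theta> ** \<rho> ** cadj (U (ls @ [l]) \<theta>) = E l \<theta> ** (U ls \<theta> ** \<rho> ** cadj (U ls \<theta>)) ** cadj (E l \<theta>)"
      by (simp add: U_def cadj_mult matrix_mul_assoc)
    then show ?thesis
      by (simp only: conjugation_nth)
  qed
  moreover have "trig_poly (\<lambda>j. (if j = l then 1 else 0) + (if j \<in> set ls then 1 else 0))
     (\<lambda>\<theta>. \<Sum>b\<in>UNIV. \<Sum>a\<in>UNIV. (E l \<theta> $ i $ a * cnj (E l \<theta> $ j $ b)) * (U ls \<theta> ** \<rho> ** cadj (U ls \<theta>)) $ a $ b)"
    unfolding E_def using snoc
    by (intro trig_poly_sum trig_poly_mult trig_poly_gate invol) (simp add: E_def)
  \<comment> \<open>Distinctness enters here: the new gate acts on a fresh parameter, so no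
    coordinate reaches degree 2.\<close>
  moreover have "(\<lambda>j. (if j = l then 1 else 0) + (if j \<in> set ls then 1 else 0)) = (\<lambda>j. if j \<in> set (ls @ [l]) then 1 else 0 :: int)"
    using snoc.prems by auto
  ultimately show ?case by simp
qed

text \<open>Each measured value has degree 1 in every coordinate, and squaring the residual doubles
  this.\<close>

lemma trig_poly_qnn_loss:
  fixes H :: "'p::{finite,linorder} \<Rightarrow> complex^'d::finite^'d"
  assumes invol: "\<And>l. H l ** H l = mat 1"
  shows "trig_poly (\<lambda>_. 2) (\<lambda>\<theta>. complex_of_real (qnn_loss H M S \<theta>))"
proof -
  define t where "t \<rho> \<theta> = ctrace (qnn_U H \<theta> ** \<rho> ** cadj (qnn_U H \<theta>) ** M)" for \<rho> \<theta>
  have "trig_poly (\<lambda>l. 1) (\<lambda>\<theta>. (qnn_U H \<theta> ** \<rho> ** cadj (qnn_U H \<theta>)) $ i $ j)" for \<rho> i j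
    using trig_poly_conjugation[OF invol, where ls = "sorted_list_of_set UNIV" and \<rho> = \<rho> and i = i and j = j] by (simp add: qnn_U_def)
  then have t: "trig_poly (\<lambda>l. 1) (t \<rho>)" for \<rho>
    unfolding t_def ctrace_def matrix_matrix_mult_def[of _ M]
    by (simp add: trig_poly_sum trig_poly_mult_const)
  \<comment> \<open>The real part is the half-sum of \<open>t\<close> and its conjugate, and
    conjugation only negates frequencies.\<close>
  have "trig_poly (\<lambda>l. 1) (\<lambda>\<theta>. (1 / 2) * (t \<rho> \<theta> + cnj (t \<rho> \<theta>)) + (- complex_of_real y))" for \<rho> y
    by (intro trig_poly_add trig_poly_cmult trig_poly_cnj t trig_poly_const) simp
  then have "trig_poly (\<lambda>l. 1) (\<lambda>\<theta>. complex_of_real (Re (t \<rho> \<theta>) - y))" for \<rho> y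
    by (simp add: complex_add_cnj)
  from trig_poly_mult[OF this this]
  have "trig_poly (\<lambda>l. 2) (\<lambda>\<theta>. complex_of_real ((Re (t \<rho> \<theta>) - y)\<^sup>2))" for \<rho> y
    by (simp add: power2_eq_square)
  then have "trig_poly (\<lambda>_. 2) (\<lambda>\<theta>. complex_of_real (1 / real (card S)) * (\<Sum>s\<in>S. complex_of_real ((Re (t (fst s) \<theta>) - snd s)\<^sup>2)))"
    by (intro trig_poly_cmult trig_poly_sum)
  then show ?thesis
    unfolding qnn_loss_def t_def by (simp add: case_prod_unfold)
qed

section \<open>Perturbation of local minima\<close>

text \<open>On the sphere, \<open>f\<close> exceeds \<open>f y\<close> by a fixed gap
  \<open>m\<close>. A small perturbation cannot close this gap, so the minimum of the perturbed
  function over the closed ball is attained inside.\<close>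

lemma strict_local_min_perturbation:
  fixes f g :: "'a::euclidean_space \<Rightarrow> real"
  assumes f: "continuous_on UNIV f" and g: "continuous_on UNIV g" and r: "0 < r"
    and strict: "\<And>z. z \<in> cball y r \<Longrightarrow> z \<noteq> y \<Longrightarrow> f y < f z"
  shows "\<forall>\<^sub>F \<epsilon> in at_right 0. \<exists>u\<in>ball y r. local_min (\<lambda>x. f x + \<epsilon> * g x) u"
proof -
  have "compact (g ` cball y r)"
    by (intro compact_continuous_image continuous_on_subset[OF g]) auto
  then obtain B where B: "B > 0" "\<And>z. z \<in> cball y r \<Longrightarrow> \<bar>g z\<bar> \<le> B"
    using compact_imp_bounded bounded_pos by (metis imageI real_norm_def)
  obtain m where m: "m > 0" "\<And>z. z \<in> sphere y r \<Longrightarrow> f y + m \<le> f z"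
  proof (cases "sphere y r = {}")
    case False
    then obtain w where w: "w \<in> sphere y r" "\<forall>z\<in>sphere y r. f w \<le> f z"
      using continuous_attains_inf[OF compact_sphere _ continuous_on_subset[OF f]] by blast
    then have "f y < f w"
      using r by (intro strict) auto
    with w show ?thesis
      by (intro that[of "f w - f y"]) auto
  qed (use that[of 1] in auto)
  \<comment> \<open>The values at \<open>y\<close> and at a boundary point each move by at most
    \<open>\<epsilon> * B\<close>, which together is less than \<open>m\<close>.\<close>
  have "\<exists>u\<in>ball y r. local_min (\<lambda>x. f x + \<epsilon> * g x) u" if \<epsilon>: "0 < \<epsilon>" "\<epsilon> < m / (2 * B)" for \<epsilon>
  proof -
    let ?h = "\<lambda>x. f x + \<epsilon> * g x"
    have "continuous_on (cball y r) ?h"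
      by (intro continuous_intros continuous_on_subset[OF f] continuous_on_subset[OF g]) auto
    then obtain u where u: "u \<in> cball y r" "\<forall>z\<in>cball y r. ?h u \<le> ?h z"
      using continuous_attains_inf[OF compact_cball, of y r ?h] r by auto
    have "2 * (\<epsilon> * B) < m"
      using \<epsilon> B(1) by (simp add: field_simps)
    have "\<epsilon> * \<bar>g z\<bar> \<le> \<epsilon> * B" if "z \<in> cball y r" for z
      using \<epsilon>(1) B(2)[OF that] by simp
    then have gB: "\<bar>\<epsilon> * g z\<bar> \<le> \<epsilon> * B" if "z \<in> cball y r" for z
      using that \<epsilon>(1) by (simp add: abs_mult)
    have "u \<notin> sphere y r"
    proof
      assume "u \<in> sphere y r"
      then have "f y + m \<le> f u" by (rule m(2))
      moreover have "?h u \<le> ?h y" using u(2) r by simp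
      ultimately show False
        using gB[OF u(1)] gB[of y] r \<open>2 * (\<epsilon> * B) < m\<close> by (simp add: abs_le_iff)
    qed
    with u(1) have ub: "u \<in> ball y r" by auto
    moreover have "local_min ?h u"
      unfolding local_min_def
    proof (intro exI[of _ "r - dist y u"] conjI allI impI)
      fix z assume "dist z u < r - dist y u"
      then have "z \<in> cball y r"
        using dist_triangle[of y z u] by (simp add: dist_commute)
      then show "?h u \<le> ?h z" using u(2) by blast
    qed (use ub in auto)
    ultimately show ?thesis by blast
  qed
  moreover have "0 < m / (2 * B)" using m B by simp
  ultimately show ?thesis
    unfolding eventually_at_right_field by blast
qed

lemma local_min_imp_critical_point:
  assumes "local_min f x" "f differentiable (at x)"
  shows "critical_point f x"
proof -
  obtain e where e: "e > 0" "\<And>y. dist y x < e \<Longrightarrow> f x \<le> f y"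
    using assms(1) unfolding local_min_def by blast
  obtain f' where f': "(f has_derivative f') (at x)"
    using assms(2) unfolding differentiable_def by blast
  have "f' = (\<lambda>_. 0)"
    by (rule differential_zero_maxmin[of x "ball x e", OF _ _ f']) (use e in \<open>auto simp: dist_commute\<close>)
  with f' show ?thesis by (simp add: critical_point_def)
qed

section \<open>Parameters modulo the period\<close>

lemma torus_point_eqD:
  assumes "torus_point x = torus_point y"
  shows "\<exists>n::int. x $ l = y $ l + pi * of_int n"
proof -
  have "cis (2 * x $ l) = cis (2 * y $ l)"
    using arg_cong[OF assms, of "\<lambda>v. v $ l"] by (simp add: torus_point_def)
  then have "sin (2 * x $ l) = sin (2 * y $ l) \<and> cos (2 * x $ l) = cos (2 * y $ l)"
    by (simp add: cis.ctr)
  then obtain n :: int where "2 * x $ l = 2 * y $ l + 2 * pi * of_int n"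
    unfolding sin_cos_eq_iff by blast
  then show ?thesis by (intro exI[of _ n]) simp
qed

lemma torus_point_locally_inj:
  assumes "torus_point x = torus_point y" "\<And>l. \<bar>x $ l - y $ l\<bar> < pi"
  shows "x = y"
proof -
  have "x $ l = y $ l" for l
  proof -
    obtain n :: int where n: "x $ l = y $ l + pi * of_int n"
      using torus_point_eqD[OF assms(1)] by blast
    then have "pi * \<bar>of_int n\<bar> < pi * 1"
      using assms(2)[of l] by (simp add: abs_mult)
    then have "\<bar>n\<bar> < 1"
      by (simp only: mult_less_cancel_left_pos[OF pi_gt_zero])
    with n show ?thesis by simp
  qed
  then show ?thesis by (simp add: vec_eq_iff)
qed

lemma inj_on_torus_point_one_period: "inj_on torus_point one_period"
proof (rule inj_onI, rule torus_point_locally_inj)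
  fix x y :: "real^'n" and l
  assume "x \<in> one_period" "y \<in> one_period"
  then have "0 \<le> x $ l" "x $ l < pi" "0 \<le> y $ l" "y $ l < pi"
    by (simp_all add: one_period_def)
  then show "\<bar>x $ l - y $ l\<bar> < pi" by linarith
qed

lemma torus_point_add: "torus_point (x + y) $ l = torus_point x $ l * torus_point y $ l"
  by (simp add: torus_point_def cis_mult distrib_left)

lemma torus_point_representative:
  obtains y where "y \<in> one_period" "torus_point y = torus_point x"
proof
  define y :: "real^'a" where "y = (\<chi> l. x $ l - pi * of_int \<lfloor>x $ l / pi\<rfloor>)"
  have "0 \<le> y $ l \<and> y $ l < pi" for l
  proof -
    have "of_int \<lfloor>x $ l / pi\<rfloor> \<le> x $ l / pi" "x $ l / pi < of_int \<lfloor>x $ l / pi\<rfloor> + 1"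
      by linarith+
    then have "pi * of_int \<lfloor>x $ l / pi\<rfloor> \<le> x $ l" "x $ l < pi * (of_int \<lfloor>x $ l / pi\<rfloor> + 1)"
      by (simp_all only: pos_le_divide_eq pos_divide_less_eq pi_gt_zero mult.commute)
    then show ?thesis
      by (simp add: y_def algebra_simps)
  qed
  then show "y \<in> one_period" by (simp add: one_period_def)
  have "cis (2 * y $ l) = cis (2 * x $ l)" for l
  proof -
    have "2 * y $ l = 2 * x $ l - 2 * pi * of_int \<lfloor>x $ l / pi\<rfloor>"
      by (simp add: y_def algebra_simps)
    then show ?thesis
      by (simp add: cis_divide[symmetric] cis_multiple_2pi)
  qed
  then show "torus_point y = torus_point x"
    by (simp add: torus_point_def vec_eq_iff)
qed

lemma continuous_on_torus_point: "continuous_on UNIV torus_point"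
  unfolding torus_point_def by (intro continuous_intros continuous_on_cis)

lemma torus_point_separation:
  assumes "torus_point x \<noteq> torus_point y"
  shows "\<forall>\<^sub>F r in at_right 0. \<forall>u\<in>cball x r. \<forall>v\<in>cball y r. torus_point u \<noteq> torus_point v"
proof -
  obtain U V where UV: "open U" "open V" "torus_point x \<in> U" "torus_point y \<in> V" "U \<inter> V = {}"
    using hausdorff[OF assms] by blast
  have "open (torus_point -` U)" "open (torus_point -` V)"
    using UV continuous_on_torus_point by (auto simp: continuous_on_open_vimage)
  then obtain r s where "r > 0" "cball x r \<subseteq> torus_point -` U" "s > 0" "cball y s \<subseteq> torus_point -` V"
    using UV by (metis open_contains_cball vimageI)
  moreover have "cball x t \<subseteq> cball x r" "cball y t \<subseteq> cball y s" if "t < min r s" for t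
    using that by auto
  ultimately show ?thesis
    unfolding eventually_at_right_field using UV(5)
    by (intro exI[of _ "min r s"]) (fastforce simp: set_eq_iff)
qed

lemma critical_point_translate:
  assumes "critical_point f z" and per: "\<And>u. f (u + (z - y)) = f u"
  shows "critical_point f y"
proof -
  have "(f has_derivative (\<lambda>_. 0)) (at (y + (z - y)))"
    using assms(1) by (simp add: critical_point_def)
  then have "((\<lambda>u. f (u + (z - y))) has_derivative (\<lambda>_. 0)) (at y)"
    by (rule has_derivative_compose[rotated]) (auto intro!: derivative_eq_intros)
  then show ?thesis
    by (simp add: per critical_point_def)
qed

text \<open>The strict inequality holds because another point of the ball with the value \<open>f y\<close> would
  itself be a local minimum, hence a critical point.\<close>

lemma local_minima_strict_and_separated:
  fixes f :: "real^'p::finite \<Rightarrow> real"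
  assumes per: "\<And>x y. torus_point x = torus_point y \<Longrightarrow> f x = f y"
    and diff: "\<And>x. f differentiable (at x)"
    and fin: "finite {\<theta> \<in> one_period. critical_point f \<theta>}"
  defines "Y \<equiv> {\<theta> \<in> one_period. local_min f \<theta>}"
  obtains r where "0 < r" "finite Y"
    "\<forall>y\<in>Y. \<forall>z\<in>cball y r. z \<noteq> y \<longrightarrow> f y < f z"
    "\<forall>x\<in>Y. \<forall>y\<in>Y. x \<noteq> y \<longrightarrow> (\<forall>u\<in>cball x r. \<forall>v\<in>cball y r. torus_point u \<noteq> torus_point v)"
proof -
  \<comment> \<open>Separation is arranged for all critical points, not only for minima, because the
    points to be excluded near a minimum are first known only to be critical.\<close>
  define C where "C = {\<theta> \<in> one_period. critical_point f \<theta>}"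
  have YC: "Y \<subseteq> C"
    using local_min_imp_critical_point diff by (auto simp: Y_def C_def)
  have "finite C"
    using fin by (simp add: C_def)
  then have "finite Y"
    using YC by (rule finite_subset[rotated])
  have "\<forall>\<^sub>F r in at_right 0. \<forall>p\<in>(C \<times> C) - Id. \<forall>u\<in>cball (fst p) r. \<forall>v\<in>cball (snd p) r. torus_point u \<noteq> torus_point v"
  proof (intro eventually_ball_finite ballI torus_point_separation)
    fix p assume "p \<in> (C \<times> C) - Id"
    then show "torus_point (fst p) \<noteq> torus_point (snd p)"
      using inj_on_torus_point_one_period by (auto simp: C_def dest: inj_onD)
  qed (simp add: \<open>finite C\<close>)
  moreover have "\<forall>\<^sub>F r in at_right 0. \<forall>y\<in>Y. \<forall>z\<in>cball y r. f y \<le> f z"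
  proof (intro eventually_ball_finite ballI \<open>finite Y\<close>)
    fix y assume "y \<in> Y"
    then obtain e where "e > 0" "\<And>z. dist z y < e \<Longrightarrow> f y \<le> f z"
      by (auto simp: Y_def local_min_def)
    then show "\<forall>\<^sub>F r in at_right 0. \<forall>z\<in>cball y r. f y \<le> f z"
      unfolding eventually_at_right_field by (intro exI[of _ e]) (auto simp: dist_commute)
  qed
  moreover have "\<forall>\<^sub>F r in at_right 0. r < pi"
    unfolding eventually_at_right_field by (intro exI[of _ pi]) auto
  moreover have "\<forall>\<^sub>F r in at_right (0::real). 0 < r"
    by (rule eventually_at_right_less)
  ultimately have "\<forall>\<^sub>F r in at_right 0. (\<forall>p\<in>(C \<times> C) - Id. \<forall>u\<in>cball (fst p) r. \<forall>v\<in>cball (snd p) r. torus_point u \<noteq> torus_point v)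
      \<and> (\<forall>y\<in>Y. \<forall>z\<in>cball y r. f y \<le> f z) \<and> r < pi \<and> 0 < r"
    by eventually_elim simp
  then obtain r where sep': "\<forall>p\<in>(C \<times> C) - Id. \<forall>u\<in>cball (fst p) r. \<forall>v\<in>cball (snd p) r. torus_point u \<noteq> torus_point v"
    and min: "\<forall>y\<in>Y. \<forall>z\<in>cball y r. f y \<le> f z" and r: "r < pi" "0 < r"
    using eventually_happens'[OF trivial_limit_at_right_real] by blast
  have sep: "torus_point u \<noteq> torus_point v" if "x \<in> C" "y \<in> C" "x \<noteq> y" "u \<in> cball x r" "v \<in> cball y r" for x y u v
    using sep'[rule_format, of "(x, y)" u v] that by simp
  \<comment> \<open>The representative \<open>w\<close> of \<open>z\<close> in the period is again
    critical by periodicity. It has the torus point of \<open>z\<close>, which lies near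
    \<open>y\<close>, so separation gives \<open>w = y\<close>; then \<open>r < pi\<close> rules out
    a nonzero multiple of the period between \<open>z\<close> and \<open>y\<close>.\<close>
  have isolated: "z = y" if y: "y \<in> C" and z: "z \<in> cball y r" "critical_point f z" for y z
  proof -
    obtain w where w: "w \<in> one_period" "torus_point w = torus_point z"
      by (rule torus_point_representative)
    have "f (u + (z - w)) = f u" for u
    proof (rule per)
      have "torus_point (u + (z - w)) $ l * torus_point w $ l = torus_point u $ l * torus_point w $ l" for l
        using w(2) torus_point_add[of "u + (z - w)" w l] torus_point_add[of u z l] by auto
      then show "torus_point (u + (z - w)) = torus_point u"
        by (auto simp: vec_eq_iff torus_point_def)
    qed
    then have "critical_point f w"
      by (rule critical_point_translate[OF z(2)])
    then have "w \<in> C" using w(1) by (simp add: C_def)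
    then have "w = y"
      using sep[of w y w z] y z(1) w(2) r by auto
    show "z = y"
    proof (rule torus_point_locally_inj)
      show "torus_point z = torus_point y" using w(2) \<open>w = y\<close> by simp
      show "\<bar>z $ l - y $ l\<bar> < pi" for l
        using component_le_norm_cart[of "z - y" l] z(1) r by (simp add: dist_norm norm_minus_commute)
    qed
  qed
  show thesis
  \<comment> \<open>Halving leaves room for a ball of radius \<open>r / 2\<close> around any
    \<open>z\<close> in \<open>cball y (r / 2)\<close> inside \<open>cball y r\<close>.\<close>
  proof (rule that[of "r / 2"])
    show "0 < r / 2" "finite Y" using r \<open>finite Y\<close> by auto
    show "\<forall>x\<in>Y. \<forall>y\<in>Y. x \<noteq> y \<longrightarrow> (\<forall>u\<in>cball x (r / 2). \<forall>v\<in>cball y (r / 2). torus_point u \<noteq> torus_point v)"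
    proof (intro ballI impI)
      fix x y u v assume "x \<in> Y" "y \<in> Y" "x \<noteq> y" "u \<in> cball x (r / 2)" "v \<in> cball y (r / 2)"
      then show "torus_point u \<noteq> torus_point v"
        using YC r by (intro sep[of x y]) auto
    qed
    show "\<forall>y\<in>Y. \<forall>z\<in>cball y (r / 2). z \<noteq> y \<longrightarrow> f y < f z"
    proof (intro ballI impI, rule ccontr)
      fix y z assume y: "y \<in> Y" and z: "z \<in> cball y (r / 2)" "z \<noteq> y"
      assume "\<not> f y < f z"
      have "local_min f z"
        unfolding local_min_def
      proof (intro exI[of _ "r / 2"] conjI allI impI)
        fix v assume "dist v z < r / 2"
        then have "v \<in> cball y r"
          using dist_triangle[of y v z] z(1) by (simp add: dist_commute)
        then show "f z \<le> f v"
          using min y \<open>\<not> f y < f z\<close> by force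
      qed (use r in auto)
      then have "critical_point f z"
        using diff by (rule local_min_imp_critical_point)
      with isolated[of y z] y YC z r show False by auto
    qed
  qed
qed

section \<open>Critical points of trigonometric sums\<close>

lemma has_derivative_chr:
  "(chr \<alpha> has_derivative (\<lambda>h. (2 * (\<Sum>l\<in>UNIV. of_int (\<alpha> l) * h $ l)) *\<^sub>R (\<i> * chr \<alpha> x))) (at x)"
  unfolding chr_def
  by (rule has_derivative_cis) (auto intro!: derivative_eq_intros bounded_linear.has_derivative[OF bounded_linear_vec_nth])

lemma trig_sum_differentiable:
  fixes f :: "real^'p::finite \<Rightarrow> real"
  assumes "\<And>\<theta>. complex_of_real (f \<theta>) = (\<Sum>\<alpha>\<in>F. a \<alpha> * chr \<alpha> \<theta>)"
  shows "f differentiable (at x)"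
proof -
  have "((\<lambda>\<theta>. Re (\<Sum>\<alpha>\<in>F. a \<alpha> * chr \<alpha> \<theta>)) has_derivative
    (\<lambda>h. Re (\<Sum>\<alpha>\<in>F. a \<alpha> * ((2 * (\<Sum>l\<in>UNIV. of_int (\<alpha> l) * h $ l)) *\<^sub>R (\<i> * chr \<alpha> x))))) (at x)"
    by (intro has_derivative_Re has_derivative_sum has_derivative_mult_right has_derivative_chr)
  moreover have "f = (\<lambda>\<theta>. Re (\<Sum>\<alpha>\<in>F. a \<alpha> * chr \<alpha> \<theta>))"
    by (simp flip: assms)
  ultimately show ?thesis
    unfolding differentiable_def by auto
qed

text \<open>The partial derivative in coordinate \<open>l\<close> multiplies
  \<open>chr \<alpha>\<close> by \<open>2 * \<i> * \<alpha> l\<close>. The cosine perturbation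
  contributes the difference of the two extreme characters, so a vanishing partial derivative is one
  equation of the Laurent system, with \<open>1 / \<epsilon>\<close> as its
  \<open>\<delta>\<close>.\<close>

lemma trig_sum_critical_point:
  fixes f :: "real^'p::finite \<Rightarrow> real"
  assumes f: "\<And>\<theta>. complex_of_real (f \<theta>) = (\<Sum>\<alpha>\<in>F. a \<alpha> * chr \<alpha> \<theta>)"
    and crit: "critical_point (\<lambda>\<theta>. f \<theta> + \<epsilon> * (\<Sum>j\<in>UNIV. cos (2 * of_int m * \<theta> $ j))) x"
    and \<epsilon>: "\<epsilon> \<noteq> 0" and m: "m \<noteq> 0"
  shows "chr ((\<lambda>_. 0)(l := m)) x - chr ((\<lambda>_. 0)(l := - m)) x
    = complex_of_real (1 / \<epsilon>) * (\<Sum>\<alpha>\<in>F. (- 2 / of_int m * of_int (\<alpha> l) * a \<alpha>) * chr \<alpha> x)"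
proof -
  let ?g = "\<lambda>\<theta> :: real^'p. \<Sum>j\<in>UNIV. cos (2 * of_int m * \<theta> $ j)"
  let ?C = "\<lambda>\<theta>. (\<Sum>\<alpha>\<in>F. a \<alpha> * chr \<alpha> \<theta>)
      + (of_real \<epsilon> / 2) * (\<Sum>j\<in>UNIV. chr ((\<lambda>_. 0)(j := m)) \<theta> + chr ((\<lambda>_. 0)(j := - m)) \<theta>)"
  let ?D = "\<lambda>h \<alpha>. (2 * (\<Sum>l\<in>UNIV. of_int (\<alpha> l) * h $ l)) *\<^sub>R (\<i> * chr \<alpha> x)"
  have cos: "complex_of_real (2 * cos t) = cis t + cis (- t)" for t
    by (simp add: complex_eq_iff)
  have "complex_of_real (f \<theta> + \<epsilon> * ?g \<theta>) = ?C \<theta>" for \<theta>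
  proof -
    have "2 * complex_of_real (?g \<theta>) = (\<Sum>j\<in>UNIV. chr ((\<lambda>_. 0)(j := m)) \<theta> + chr ((\<lambda>_. 0)(j := - m)) \<theta>)"
      using cos by (simp add: chr_single sum_distrib_left)
    then show ?thesis by (simp add: f mult.commute)
  qed
  moreover have "((\<lambda>\<theta>. complex_of_real (f \<theta> + \<epsilon> * ?g \<theta>)) has_derivative (\<lambda>h. complex_of_real 0)) (at x)"
    using crit unfolding critical_point_def by (rule has_derivative_of_real)
  ultimately have "(?C has_derivative (\<lambda>h. 0)) (at x)"
    by simp
  moreover have "(?C has_derivative (\<lambda>h. (\<Sum>\<alpha>\<in>F. a \<alpha> * ?D h \<alpha>)
      + (of_real \<epsilon> / 2) * (\<Sum>j\<in>UNIV. ?D h ((\<lambda>_. 0)(j := m)) + ?D h ((\<lambda>_. 0)(j := - m))))) (at x)"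
    by (intro has_derivative_add has_derivative_sum has_derivative_mult_right has_derivative_chr)
  ultimately have "(\<lambda>h. 0) = (\<lambda>h. (\<Sum>\<alpha>\<in>F. a \<alpha> * ?D h \<alpha>)
      + (of_real \<epsilon> / 2) * (\<Sum>j\<in>UNIV. ?D h ((\<lambda>_. 0)(j := m)) + ?D h ((\<lambda>_. 0)(j := - m))))"
    by (rule has_derivative_unique)
  \<comment> \<open>The two derivatives of the complexified function are compared in direction
    \<open>l\<close>, where only the \<open>l\<close>-th entry of each frequency survives.\<close>
  from fun_cong[OF this, of "axis l 1"]
  have zero: "0 = (\<Sum>\<alpha>\<in>F. a \<alpha> * ?D (axis l 1) \<alpha>)
      + (of_real \<epsilon> / 2) * (\<Sum>j\<in>UNIV. ?D (axis l 1) ((\<lambda>_. 0)(j := m)) + ?D (axis l 1) ((\<lambda>_. 0)(j := - m)))"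
    by simp
  have axis: "(\<Sum>i\<in>UNIV. of_int (\<alpha> i) * axis l (1::real) $ i) = of_int (\<alpha> l)" for \<alpha> :: "'p \<Rightarrow> int"
  proof -
    have "(\<Sum>i\<in>UNIV. of_int (\<alpha> i) * axis l (1::real) $ i) = (\<Sum>i\<in>UNIV. if i = l then of_int (\<alpha> l) else 0)"
      by (rule sum.cong) (auto simp: axis_def)
    then show ?thesis by simp
  qed
  have "(\<Sum>j\<in>UNIV. ?D (axis l 1) ((\<lambda>_. 0)(j := m)) + ?D (axis l 1) ((\<lambda>_. 0)(j := - m)))
    = (\<Sum>j\<in>UNIV. if j = l then 2 * \<i> * of_int m * (chr ((\<lambda>_. 0)(l := m)) x - chr ((\<lambda>_. 0)(l := - m)) x) else 0)"
    unfolding axis by (rule sum.cong) (auto simp: scaleR_conv_of_real algebra_simps)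
  then have g: "(\<Sum>j\<in>UNIV. ?D (axis l 1) ((\<lambda>_. 0)(j := m)) + ?D (axis l 1) ((\<lambda>_. 0)(j := - m)))
    = 2 * \<i> * of_int m * (chr ((\<lambda>_. 0)(l := m)) x - chr ((\<lambda>_. 0)(l := - m)) x)"
    by simp
  have s: "(\<Sum>\<alpha>\<in>F. a \<alpha> * ?D (axis l 1) \<alpha>) = 2 * \<i> * (\<Sum>\<alpha>\<in>F. of_int (\<alpha> l) * a \<alpha> * chr \<alpha> x)"
    unfolding axis by (simp add: scaleR_conv_of_real sum_distrib_left mult_ac)
  define d where "d = chr ((\<lambda>_. 0)(l := m)) x - chr ((\<lambda>_. 0)(l := - m)) x"
  define t where "t = (\<Sum>\<alpha>\<in>F. of_int (\<alpha> l) * a \<alpha> * chr \<alpha> x)"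
  have "\<i> * (2 * t + of_real \<epsilon> * of_int m * d) = 0"
    using zero unfolding g s d_def[symmetric] t_def[symmetric] by (simp add: algebra_simps)
  then have "2 * t + of_real \<epsilon> * of_int m * d = 0"
    by (simp only: mult_eq_0_iff complex_i_not_zero simp_thms)
  then have "of_real \<epsilon> * of_int m * d = - 2 * t"
    by (simp add: add_eq_0_iff)
  then have "d = complex_of_real (1 / \<epsilon>) * (- 2 / of_int m * t)"
    using \<epsilon> m by (simp add: field_simps)
  also have "- 2 / of_int m * t = (\<Sum>\<alpha>\<in>F. (- 2 / of_int m * of_int (\<alpha> l) * a \<alpha>) * chr \<alpha> x)"
    unfolding t_def by (simp only: sum_distrib_left mult.assoc)
  finally show ?thesis
    unfolding d_def .
qed

text \<open>The minima of \<open>f\<close> are carried injectively to critical points of a generic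
  perturbation, and these are counted by \<open>generic_laurent_system_bound\<close>.\<close>

lemma trig_poly_local_minima_bound:
  fixes f :: "real^'p::finite \<Rightarrow> real"
  assumes f: "trig_poly (\<lambda>_. k) (\<lambda>\<theta>. complex_of_real (f \<theta>))" and k: "0 < k"
    and fin: "finite {\<theta> \<in> one_period. critical_point f \<theta>}"
  defines "Y \<equiv> {\<theta> \<in> one_period. local_min f \<theta>}"
  shows "finite Y \<and> card Y \<le> nat (2 * (k * int CARD('p))) ^ CARD('p)"
proof -
  define F :: "('p \<Rightarrow> int) set" where "F = {\<alpha>. \<forall>l. \<alpha> l \<in> {- k..k}}"
  \<comment> \<open>The largest norm that a frequency in \<open>F\<close> can have, as the Laurent
    bound requires.\<close>
  define m where "m = k * int CARD('p)"
  have "0 < m" using k by (simp add: m_def)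
  have F: "finite F"
    unfolding F_def by (rule finite_bounded_freqs)
  have Fm: "\<forall>\<alpha>\<in>F. freq_norm \<alpha> \<le> m"
  proof
    fix \<alpha> assume "\<alpha> \<in> F"
    then have "freq_norm \<alpha> \<le> (\<Sum>l\<in>(UNIV :: 'p set). k)"
      unfolding freq_norm_def by (intro sum_mono) (auto simp: F_def abs_le_iff minus_le_iff)
    then show "freq_norm \<alpha> \<le> m" by (simp add: m_def mult.commute)
  qed
  obtain a where a: "\<And>\<theta>. complex_of_real (f \<theta>) = (\<Sum>\<alpha>\<in>F. a \<alpha> * chr \<alpha> \<theta>)"
    using trig_poly_expansion[OF f] unfolding F_def by blast
  have diff: "f differentiable (at x)" for x
    using a by (rule trig_sum_differentiable)
  have per: "f x = f y" if "torus_point x = torus_point y" for x y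
  proof -
    have "complex_of_real (f x) = complex_of_real (f y)"
      using that by (simp only: a chr_prod)
    then show ?thesis by simp
  qed
  define g where "g = (\<lambda>\<theta> :: real^'p. \<Sum>j\<in>UNIV. cos (2 * of_int m * \<theta> $ j))"
  have gdiff: "g differentiable (at x)" for x
    unfolding g_def differentiable_def by (auto intro!: derivative_eq_intros bounded_linear.has_derivative[OF bounded_linear_vec_nth] exI)
  obtain r where r: "0 < r" "finite Y"
    and strict: "\<forall>y\<in>Y. \<forall>z\<in>cball y r. z \<noteq> y \<longrightarrow> f y < f z"
    and sep: "\<forall>x\<in>Y. \<forall>y\<in>Y. x \<noteq> y \<longrightarrow> (\<forall>u\<in>cball x r. \<forall>v\<in>cball y r. torus_point u \<noteq> torus_point v)"
    unfolding Y_def by (rule local_minima_strict_and_separated[OF per diff fin])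
  have "continuous_on UNIV f" "continuous_on UNIV g"
    using diff gdiff by (auto intro!: differentiable_imp_continuous_on simp: differentiable_on_def)
  then have "\<forall>\<^sub>F \<epsilon> in at_right 0. \<forall>y\<in>Y. \<exists>u\<in>ball y r. local_min (\<lambda>x. f x + \<epsilon> * g x) u"
    by (intro eventually_ball_finite ballI strict_local_min_perturbation strict[rule_format] r) auto
  then obtain e where e: "0 < e" "\<And>\<epsilon>. 0 < \<epsilon> \<Longrightarrow> \<epsilon> < e \<Longrightarrow> \<forall>y\<in>Y. \<exists>u\<in>ball y r. local_min (\<lambda>x. f x + \<epsilon> * g x) u"
    unfolding eventually_at_right_field by blast
  obtain D where D: "countable D" and bound: "\<And>\<delta> X. \<delta> \<notin> D \<Longrightarrow> finite X \<Longrightarrow> inj_on torus_point X \<Longrightarrow>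
       (\<And>x l. x \<in> X \<Longrightarrow> chr ((\<lambda>_. 0)(l := m)) x - chr ((\<lambda>_. 0)(l := - m)) x
          = \<delta> * (\<Sum>\<alpha>\<in>F. (- 2 / of_int m * of_int (\<alpha> l) * a \<alpha>) * chr \<alpha> x)) \<Longrightarrow>
       card X \<le> nat (2 * m) ^ CARD('p)"
    using generic_laurent_system_bound[OF F Fm \<open>0 < m\<close>, where b = "\<lambda>l \<alpha>. - 2 / of_int m * of_int (\<alpha> l) * a \<alpha>"] by blast
  \<comment> \<open>The reciprocals of the interval from 0 to \<open>e\<close> are uncountable, so
    some of them avoid the countable set \<open>D\<close>.\<close>
  obtain \<epsilon> where \<epsilon>: "0 < \<epsilon>" "\<epsilon> < e" "complex_of_real (1 / \<epsilon>) \<notin> D"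
  proof -
    have "inj_on (\<lambda>\<epsilon>. complex_of_real (1 / \<epsilon>)) {0<..<e}"
      by (rule inj_onI) (simp only: of_real_eq_iff, simp)
    then have "\<not> (\<lambda>\<epsilon>. complex_of_real (1 / \<epsilon>)) ` {0<..<e} \<subseteq> D"
      using D e(1) uncountable_open_interval[of 0 e] countable_subset countable_image_inj_on by metis
    then obtain x where "x \<in> {0<..<e}" "complex_of_real (1 / x) \<notin> D"
      by blast
    then show thesis by (intro that[of x]) simp_all
  qed
  obtain u where u: "\<And>y. y \<in> Y \<Longrightarrow> u y \<in> ball y r" "\<And>y. y \<in> Y \<Longrightarrow> local_min (\<lambda>x. f x + \<epsilon> * g x) (u y)"
    using bchoice[OF e(2)[OF \<epsilon>(1,2), unfolded Bex_def]] by blast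
  \<comment> \<open>A perturbed minimum may leave \<open>one_period\<close>, so distinctness is
    needed for torus points; it comes from the separated balls.\<close>
  have inj: "inj_on (torus_point \<circ> u) Y"
  proof (rule inj_onI, rule ccontr)
    fix x y assume *: "x \<in> Y" "y \<in> Y" "(torus_point \<circ> u) x = (torus_point \<circ> u) y" "x \<noteq> y"
    have "u x \<in> cball x r" "u y \<in> cball y r"
      using u(1)[OF *(1)] u(1)[OF *(2)] by auto
    with sep * show False by auto
  qed
  have "card (u ` Y) \<le> nat (2 * m) ^ CARD('p)"
  proof (rule bound[OF \<epsilon>(3)])
    show "finite (u ` Y)" using r by simp
    show "inj_on torus_point (u ` Y)" using inj by (rule inj_on_imageI)
    fix x l assume "x \<in> u ` Y"
    then have "local_min (\<lambda>x. f x + \<epsilon> * g x) x" using u by auto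
    moreover have "(\<lambda>x. f x + \<epsilon> * g x) differentiable (at x)"
      using diff gdiff by (intro differentiable_add differentiable_mult differentiable_const)
    ultimately have "critical_point (\<lambda>x. f x + \<epsilon> * g x) x"
      by (rule local_min_imp_critical_point)
    then show "chr ((\<lambda>_. 0)(l := m)) x - chr ((\<lambda>_. 0)(l := - m)) x
        = complex_of_real (1 / \<epsilon>) * (\<Sum>\<alpha>\<in>F. (- 2 / of_int m * of_int (\<alpha> l) * a \<alpha>) * chr \<alpha> x)"
      unfolding g_def using \<epsilon>(1) \<open>0 < m\<close> by (intro trig_sum_critical_point[OF a]) auto
  qed
  moreover have "card (u ` Y) = card Y"
    using inj by (intro card_image) (rule inj_on_imageI2)
  ultimately show ?thesis
    using r(2) by (simp add: m_def)
qed

theorem theorem3: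
  fixes H :: "'p::{finite,linorder} \<Rightarrow> complex^'d^'d"
    and M :: "complex^'d^'d"
    and S :: "((complex^'d^'d) \<times> real) set"
  assumes herm: "\<And>l. hermitian_mat (H l)"
    and invol: "\<And>l. H l ** H l = mat 1"
    and hermM: "hermitian_mat M"
    and finS: "finite S"
    and dens: "\<And>\<rho> y. (\<rho>, y) \<in> S \<Longrightarrow> density_mat \<rho>"
    and nondeg: "finite {\<theta> \<in> one_period. critical_point (qnn_loss H M S) \<theta>}"
  shows "finite {\<theta> \<in> one_period. local_min (qnn_loss H M S) \<theta>}
       \<and> card {\<theta> \<in> one_period. local_min (qnn_loss H M S) \<theta>}
           \<le> (4 * CARD('p)) ^ CARD('p)"
proof -
  \<comment> \<open>The loss has degree \<open>k = 2\<close> in each coordinate, which turns the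
    general bound into the stated one.\<close>
  have "nat (2 * (2 * int CARD('p))) = 4 * CARD('p)"
    by (simp add: nat_mult_distrib)
  then show ?thesis
    using trig_poly_local_minima_bound[OF trig_poly_qnn_loss[OF invol] _ nondeg] by simp
qed

end
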